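(* Let $T>0$, $\mu>0$, $f\in L^2(0,T)$, and let the discrete spaces $S_h^p(0,T)\subset H^2_{0,\bullet}(0,T)$ satisfy Assumption A (stated in the context). Let $u\in H^2_{0,\bullet}(0,T)$ be the unique solution of $$a_\mu(u,w)=(f,\partial_tw)_{L^2(0,T)}\quad\text{for all }w\in H^2_{0,\bullet}(0,T),$$ and let $u_h\in S_h^p(0,T)$ be the unique solution of $$a_\mu(u_h,\mathcal{L}_Tw_h)=(f,\partial_t\mathcal{L}_Tw_h)_{L^2(0,T)}\quad\text{for all }w_h\in S_h^p(0,T).$$ If $u\in H^2_{0,\bullet}(0,T)\cap H^{s+1}(0,T)$ for an integer $s$ with $1\le s\le p$, then $$\|\partial_tu-\partial_tu_h\|_{L^2(0,T)}\le C_\mu\,h^{s-1}\,\|\partial_t^{s+1}u\|_{L^2(0,T)},$$ for a positive constant $C_\mu$ depending on $p,T,\mu$ but not on $h$.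
   Context: $H^2_{0,\bullet}(0,T):=\{u\in H^2(0,T): u(0)=0\}$, with norm $\|u\|_{H^2_{0,\bullet}(0,T)}:=\|\partial_t^2u\|_{L^2(0,T)}+\frac1T\|\partial_tu\|_{L^2(0,T)}$; $$a_\mu(u,w):=(\partial_t^2u,\partial_t w)_{L^2(0,T)}+\partial_tu(0)\,\partial_tw(0)+\mu\,(u,\partial_tw)_{L^2(0,T)};\qquad \mathcal{L}_Tw(t):=\int_0^te^{-s/T}\partial_sw(s)\,\mathrm{d}s .$$ $\{S_h^p(0,T)\}_h$ is a family of finite dimensional subspaces of $H^2_{0,\bullet}(0,T)$, depending on a mesh parameter $h>0$, for a fixed polynomial degree $p$. Assumption A: (i) there is a constant $C_I>0$, depending on $p$ but not on $h$, such that for all $w_h\in S_h^p(0,T)$: $\|w_h\|_{H^2_{0,\bullet}(0,T)}\le C_Ih^{-1}\|\partial_tw_h\|_{L^2(0,T)}$ and $\|\partial_tw_h\|_{L^2(0,T)}\le C_Ih^{-1}\|w_h\|_{L^2(0,T)}$. (ii) There is a constant $C_a>0$, depending on $p$ but not on $h$, such that for each integer $0\le s\le p$ and each $w\in H^2_{0,\bullet}(0,T)\cap H^{s+1}(0,T)$ there is a function $\widetilde w_h\in S_h^p(0,T)$ with $\|\partial_t^\ell w-\partial_t^\ell\widetilde w_h\|_{L^2(0,T)}\le C_ah^{s+1-\ell}\|\partial_t^{s+1}w\|_{L^2(0,T)}$ for all $\ell\in\{0,1,2\}$ with $\ell\le s$, and, if in addition $w\in W^{s+1}_\infty(0,T)$,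 also $\|\partial_tw-\partial_t\widetilde w_h\|_{L^\infty(0,T)}\le C_ah^s\|\partial_t^{s+1}w\|_{L^\infty(0,T)}$. Since $C_I,C_a$ count as depending on $p$, the constant $C_\mu$ may depend on them. *)

theory Defs
  imports "HOL-Analysis.Analysis" "HOL-Probability.Essential_Supremum"
begin

text \<open>
  Elements of the Lebesgue and Sobolev spaces over \<open>(0,T)\<close> are represented by functions on
  the whole real line. Only their values almost everywhere on \<open>(0,T)\<close> matter: all spaces,
  norms, forms and point values below are invariant under changes on null sets and
  outside \<open>(0,T)\<close>.
\<close>

abbreviation leb :: "real \<Rightarrow> real measure"
  where "leb T \<equiv> lebesgue_on {0<..<T}"

definition L2_space :: "real \<Rightarrow> (real \<Rightarrow> real) set"
  where "L2_space T = {f \<in> borel_measurable (leb T). integrable (leb T) (\<lambda>t. (f t)\<^sup>2)}"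

definition L2_inner :: "real \<Rightarrow> (real \<Rightarrow> real) \<Rightarrow> (real \<Rightarrow> real) \<Rightarrow> real"
  where "L2_inner T f g = (\<integral>t. f t * g t \<partial>leb T)"

definition L2_nrm :: "real \<Rightarrow> (real \<Rightarrow> real) \<Rightarrow> real"
  where "L2_nrm T f = sqrt (L2_inner T f f)"

definition Linf_space :: "real \<Rightarrow> (real \<Rightarrow> real) set"
  where "Linf_space T =
    {f \<in> borel_measurable (leb T). esssup (leb T) (\<lambda>t. ereal \<bar>f t\<bar>) < \<infinity>}"

definition Linf_nrm :: "real \<Rightarrow> (real \<Rightarrow> real) \<Rightarrow> real"
  where "Linf_nrm T f = real_of_ereal (esssup (leb T) (\<lambda>t. ereal \<bar>f t\<bar>))"

definition test_functions :: "real \<Rightarrow> (real \<Rightarrow> real) set"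
  where "test_functions T =
    {\<phi>. (\<forall>k x. (deriv ^^ k) \<phi> field_differentiable at x) \<and>
         (\<exists>a b. 0 < a \<and> b < T \<and> (\<forall>x. x \<notin> {a..b} \<longrightarrow> \<phi> x = 0))}"

definition L1_loc :: "real \<Rightarrow> (real \<Rightarrow> real) set"
  where "L1_loc T = {f. \<forall>a b. 0 < a \<longrightarrow> b < T \<longrightarrow> set_integrable lebesgue {a..b} f}"

definition has_weak_deriv :: "real \<Rightarrow> nat \<Rightarrow> (real \<Rightarrow> real) \<Rightarrow> (real \<Rightarrow> real) \<Rightarrow> bool"
  where "has_weak_deriv T k u v \<longleftrightarrow> u \<in> L1_loc T \<and> v \<in> L1_loc T \<and>
    (\<forall>\<phi>\<in>test_functions T.
       (\<integral>t. u t * (deriv ^^ k) \<phi> t \<partial>leb T) = (-1) ^ k * (\<integral>t. v t * \<phi> t \<partial>leb T))"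

text \<open>
  The weak derivative of order \<open>k\<close>; it is unique only up to null sets, and one
  representative is chosen (for \<open>k = 0\<close>, a function equal to \<open>u\<close> almost everywhere).
\<close>
definition wderiv :: "real \<Rightarrow> nat \<Rightarrow> (real \<Rightarrow> real) \<Rightarrow> (real \<Rightarrow> real)"
  where "wderiv T k u = (SOME v. has_weak_deriv T k u v)"

definition H_space :: "nat \<Rightarrow> real \<Rightarrow> (real \<Rightarrow> real) set"
  where "H_space k T =
    {u \<in> L2_space T. \<forall>j\<le>k. \<exists>v\<in>L2_space T. has_weak_deriv T j u v}"

definition Winf_space :: "nat \<Rightarrow> real \<Rightarrow> (real \<Rightarrow> real) set"
  where "Winf_space k T =
    {u \<in> Linf_space T. \<forall>j\<le>k. \<exists>v\<in>Linf_space T. has_weak_deriv T j u v}"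

text \<open>
  The value of \<open>u\<close> at \<open>t\<^sub>0\<close>, understood as that of the continuous representative of \<open>u\<close>
  on \<open>[0,T]\<close>. It exists and is unique for \<open>u\<close> in \<open>H\<^sup>1(0,T)\<close> and \<open>t\<^sub>0\<close> in \<open>[0,T]\<close>.
\<close>
definition pt_val :: "real \<Rightarrow> (real \<Rightarrow> real) \<Rightarrow> real \<Rightarrow> real"
  where "pt_val T u t\<^sub>0 =
    (THE c. \<exists>g. continuous_on {0..T} g \<and> (AE t in leb T. u t = g t) \<and> c = g t\<^sub>0)"

definition H20 :: "real \<Rightarrow> (real \<Rightarrow> real) set"
  where "H20 T = {u \<in> H_space 2 T. pt_val T u 0 = 0}"

definition H20_nrm :: "real \<Rightarrow> (real \<Rightarrow> real) \<Rightarrow> real"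
  where "H20_nrm T u = L2_nrm T (wderiv T 2 u) + 1 / T * L2_nrm T (wderiv T 1 u)"

definition a_form :: "real \<Rightarrow> real \<Rightarrow> (real \<Rightarrow> real) \<Rightarrow> (real \<Rightarrow> real) \<Rightarrow> real"
  where "a_form T \<mu> u w =
    L2_inner T (wderiv T 2 u) (wderiv T 1 w)
    + pt_val T (wderiv T 1 u) 0 * pt_val T (wderiv T 1 w) 0
    + \<mu> * L2_inner T u (wderiv T 1 w)"

definition LT :: "real \<Rightarrow> (real \<Rightarrow> real) \<Rightarrow> (real \<Rightarrow> real)"
  where "LT T w t = (LINT s:{0..t}|lebesgue. exp (- s / T) * wderiv T 1 w s)"

text \<open>
  A finite dimensional subspace is given as the span of finitely many functions. In terms
  of classes modulo null sets this is no restriction: choose representatives of a basis.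
\<close>
definition finite_dim_subspace :: "(real \<Rightarrow> real) set \<Rightarrow> bool"
  where "finite_dim_subspace V \<longleftrightarrow>
    (\<exists>(n::nat) b. V = {(\<lambda>t. \<Sum>i<n. c i * b i t) | c :: nat \<Rightarrow> real. True})"

text \<open>
  \<open>hs\<close> is the set of mesh parameters that index the family \<open>S\<close>.
\<close>
definition discrete_family :: "real \<Rightarrow> real set \<Rightarrow> (real \<Rightarrow> (real \<Rightarrow> real) set) \<Rightarrow> bool"
  where "discrete_family T hs S \<longleftrightarrow>
    (\<forall>h\<in>hs. 0 < h \<and> finite_dim_subspace (S h) \<and> S h \<subseteq> H20 T)"

definition inverse_inequalities ::
    "real \<Rightarrow> real \<Rightarrow> real set \<Rightarrow> (real \<Rightarrow> (real \<Rightarrow> real) set) \<Rightarrow> bool"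
  where "inverse_inequalities T C\<^sub>I hs S \<longleftrightarrow>
    (\<forall>h\<in>hs. \<forall>w\<in>S h.
       H20_nrm T w \<le> C\<^sub>I * inverse h * L2_nrm T (wderiv T 1 w) \<and>
       L2_nrm T (wderiv T 1 w) \<le> C\<^sub>I * inverse h * L2_nrm T w)"

definition approximation_property ::
    "real \<Rightarrow> nat \<Rightarrow> real \<Rightarrow> real set \<Rightarrow> (real \<Rightarrow> (real \<Rightarrow> real) set) \<Rightarrow> bool"
  where "approximation_property T p C\<^sub>a hs S \<longleftrightarrow>
    (\<forall>h\<in>hs. \<forall>s\<le>p. \<forall>w\<in>H20 T \<inter> H_space (s + 1) T. \<exists>v\<in>S h.
       (\<forall>l\<in>{0, 1, 2}. l \<le> s \<longrightarrow>
          L2_nrm T (\<lambda>t. wderiv T l w t - wderiv T l v t)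
            \<le> C\<^sub>a * h ^ (s + 1 - l) * L2_nrm T (wderiv T (s + 1) w)) \<and>
       (w \<in> Winf_space (s + 1) T \<longrightarrow>
          Linf_nrm T (\<lambda>t. wderiv T 1 w t - wderiv T 1 v t)
            \<le> C\<^sub>a * h ^ s * Linf_nrm T (wderiv T (s + 1) w)))"

definition assumption_A ::
    "real \<Rightarrow> nat \<Rightarrow> real \<Rightarrow> real \<Rightarrow> real set \<Rightarrow> (real \<Rightarrow> (real \<Rightarrow> real) set) \<Rightarrow> bool"
  where "assumption_A T p C\<^sub>I C\<^sub>a hs S \<longleftrightarrow>
    inverse_inequalities T C\<^sub>I hs S \<and> approximation_property T p C\<^sub>a hs S"

definition continuous_solution ::
    "real \<Rightarrow> real \<Rightarrow> (real \<Rightarrow> real) \<Rightarrow> (real \<Rightarrow> real) \<Rightarrow> bool"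
  where "continuous_solution T \<mu> f u \<longleftrightarrow> u \<in> H20 T \<and>
    (\<forall>w\<in>H20 T. a_form T \<mu> u w = L2_inner T f (wderiv T 1 w))"

definition discrete_solution ::
    "real \<Rightarrow> real \<Rightarrow> (real \<Rightarrow> real) set \<Rightarrow> (real \<Rightarrow> real) \<Rightarrow> (real \<Rightarrow> real) \<Rightarrow> bool"
  where "discrete_solution T \<mu> V f u \<longleftrightarrow> u \<in> V \<and>
    (\<forall>w\<in>V. a_form T \<mu> u (LT T w) = L2_inner T f (wderiv T 1 (LT T w)))"

end

(*
  Testing with L_T e multiplies the derivative of e by the weight exp (-t/T). Integrating the
  derivatives of (e')^2 exp (-t/T) and e^2 exp (-t/T) shows that
  a_mu (e, L_T e) >= |e'|^2 / (2 e T) + e'(0)^2 / 2 whenever e(0) = 0. With Galerkin orthogonality,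
  e = u_h - v, and the half square e'(0)^2 / 2 absorbing the trace term, this gives for every v in
  the discrete space
    |u' - u_h'| <= 3 |u' - v'| + 8 T |u'' - v''| + 6 T mu |u - v|.
  For s = 1 the approximation property says nothing about second derivatives; there v = 0 suffices,
  because the natural boundary condition u'(0) = 0 bounds u and u' by u''. For s >= 2 take v from
  the approximation property: the surplus powers of h are bounded by powers of T C_I, since an
  inverse inequality with h > T C_I forces the discrete space to be trivial.
*)
theory Submission
  imports Defs "HOL-Computational_Algebra.Polynomial"
begin

section \<open>Smooth functions and test functions\<close>

text \<open>The weight is needed because without it the product of e'' and e' integrates to boundary
  terms alone; the decay rate 1/T of exp (-t/T) is what produces the square norm of e'. The same
  weight makes the mass term nonnegative, so \<open>\<mu>\<close> enters only through the right-hand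
  side. L_T e need not belong to the discrete space; orthogonality only uses that it is an
  admissible test function for both problems. One power of h is lost because the residual u'' - v''
  is measured directly in L2. The obstacle is that the objects are classes modulo null sets:
  \<open>wderiv\<close> is an arbitrary choice, \<open>pt_val\<close> a description, and membership
  in \<open>H_space\<close> asserts each weak derivative separately. Integration by parts and traces
  need genuine functions. Hence the chain from smooth bumps through the fundamental lemma of the
  calculus of variations to absolutely continuous representatives, in terms of which all estimates
  are carried out.\<close>

definition smooth :: "(real \<Rightarrow> real) \<Rightarrow> bool"
  where "smooth \<phi> \<longleftrightarrow> (\<forall>k x. (deriv ^^ k) \<phi> field_differentiable at x)"

text \<open>Coinduction for smoothness: every iterated derivative stays in \<open>F\<close>, so no
  formula for higher derivatives is needed.\<close>

lemma smoothI_closed: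
  assumes "\<phi> \<in> F"
    and closed: "\<And>f. f \<in> F \<Longrightarrow> \<exists>f'\<in>F. \<forall>x. (f has_real_derivative f' x) (at x)"
  shows "smooth \<phi>"
proof -
  have deriv_in: "deriv f \<in> F" if f: "f \<in> F" for f
  proof -
    obtain f' where f': "f' \<in> F" "\<forall>x. (f has_real_derivative f' x) (at x)"
      using closed[OF f] by blast
    then have "deriv f = f'" by (auto intro: DERIV_imp_deriv)
    with f' show ?thesis by simp
  qed
  have "(deriv ^^ k) \<phi> \<in> F" for k
    by (induction k) (use assms(1) deriv_in in auto)
  then show ?thesis
    unfolding smooth_def using closed by (meson field_differentiable_def)
qed

lemma smooth_has_deriv: "smooth f \<Longrightarrow> (f has_real_derivative deriv f x) (at x)"
  unfolding smooth_def by (metis DERIV_deriv_iff_field_differentiable funpow_0)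

lemma smooth_deriv: "smooth f \<Longrightarrow> smooth (deriv f)"
  unfolding smooth_def by (metis comp_apply funpow_Suc_right)

lemma smooth_continuous: "smooth f \<Longrightarrow> continuous_on A f"
  by (meson DERIV_continuous continuous_at_imp_continuous_on smooth_has_deriv)

lemma smooth_of_deriv:
  assumes "\<And>x. (f has_real_derivative g x) (at x)" and "smooth g"
  shows "smooth f"
proof -
  have g: "deriv f = g" using assms(1) by (auto intro: DERIV_imp_deriv)
  show ?thesis
    unfolding smooth_def
  proof (intro allI)
    fix k x
    show "(deriv ^^ k) f field_differentiable at x"
    proof (cases k)
      case 0
      then show ?thesis using assms(1) by (auto simp: field_differentiable_def)
    next
      case (Suc m)
      then have "(deriv ^^ k) f = (deriv ^^ m) g"
        using g by (simp add: funpow_swap1)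
      then show ?thesis using assms(2) by (simp add: smooth_def)
    qed
  qed
qed

text \<open>The derivative of a product is a sum of products, so the closure properties cannot be
  proved one at a time by \<open>smoothI_closed\<close>. One family containing all these operations
  is closed under differentiation.\<close>

inductive_set smooth_algebra :: "(real \<Rightarrow> real) set"
  where
    base: "smooth f \<Longrightarrow> f \<in> smooth_algebra"
  | add: "f \<in> smooth_algebra \<Longrightarrow> g \<in> smooth_algebra \<Longrightarrow> (\<lambda>x. f x + g x) \<in> smooth_algebra"
  | mult: "f \<in> smooth_algebra \<Longrightarrow> g \<in> smooth_algebra \<Longrightarrow> (\<lambda>x. f x * g x) \<in> smooth_algebra"
  | affine: "f \<in> smooth_algebra \<Longrightarrow> (\<lambda>x. f (c * x + d)) \<in> smooth_algebra"

lemma smooth_const: "smooth (\<lambda>_. c)"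
proof (rule smoothI_closed[of _ "range (\<lambda>c _. c)"])
  fix f :: "real \<Rightarrow> real"
  assume "f \<in> range (\<lambda>c _. c)"
  then show "\<exists>f'\<in>range (\<lambda>c _. c). \<forall>x. (f has_real_derivative f' x) (at x)"
    by (intro bexI[of _ "\<lambda>_. 0"]) auto
qed auto

lemma smooth_algebra_smooth:
  assumes "f \<in> smooth_algebra"
  shows "smooth f"
proof (rule smoothI_closed[OF assms])
  fix f assume "f \<in> smooth_algebra"
  then show "\<exists>f'\<in>smooth_algebra. \<forall>x. (f has_real_derivative f' x) (at x)"
  proof induction
    case (base f)
    then show ?case
      by (intro bexI[of _ "deriv f"] smooth_algebra.base smooth_deriv allI smooth_has_deriv)
  next
    case (add f g)
    then obtain f' g' where "f' \<in> smooth_algebra" "g' \<in> smooth_algebra"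
      and "\<forall>x. (f has_real_derivative f' x) (at x)" "\<forall>x. (g has_real_derivative g' x) (at x)"
      by blast
    then show ?case
      by (intro bexI[of _ "\<lambda>x. f' x + g' x"] smooth_algebra.add) (auto intro!: DERIV_add)
  next
    case (mult f g)
    then obtain f' g' where "f' \<in> smooth_algebra" "g' \<in> smooth_algebra"
      and "\<forall>x. (f has_real_derivative f' x) (at x)" "\<forall>x. (g has_real_derivative g' x) (at x)"
      by blast
    then show ?case using mult.hyps
      by (intro bexI[of _ "\<lambda>x. f' x * g x + g' x * f x"] smooth_algebra.add smooth_algebra.mult)
        (auto intro!: DERIV_mult)
  next
    case (affine f c d)
    then obtain f' where f': "f' \<in> smooth_algebra" "\<And>x. (f has_real_derivative f' x) (at x)"
      by blast
    have "((\<lambda>x. f (c * x + d)) has_real_derivative c * f' (c * x + d)) (at x)" for x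
      by (rule DERIV_cong[OF DERIV_chain2[OF f'(2)]]) (auto intro!: derivative_eq_intros)
    moreover have "(\<lambda>x. c * f' (c * x + d)) \<in> smooth_algebra"
      by (rule smooth_algebra.mult[OF smooth_algebra.base[OF smooth_const]
            smooth_algebra.affine[OF f'(1)]])
    ultimately show ?case
      by (intro bexI[of _ "\<lambda>x. c * f' (c * x + d)"] allI)
  qed
qed

lemma smooth_add: "smooth f \<Longrightarrow> smooth g \<Longrightarrow> smooth (\<lambda>x. f x + g x)"
  by (rule smooth_algebra_smooth[OF smooth_algebra.add[OF smooth_algebra.base smooth_algebra.base]])

lemma smooth_mult: "smooth f \<Longrightarrow> smooth g \<Longrightarrow> smooth (\<lambda>x. f x * g x)"
  by (rule smooth_algebra_smooth[OF smooth_algebra.mult[OF smooth_algebra.base smooth_algebra.base]])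

lemma smooth_affine: "smooth f \<Longrightarrow> smooth (\<lambda>x. f (c * x + d))"
  by (rule smooth_algebra_smooth[OF smooth_algebra.affine[OF smooth_algebra.base]])

section \<open>Bump functions built from exp (-1/y)\<close>

text \<open>For \<open>P = 1\<close> this is the classical function that is flat at 0. The
  polynomial factor makes the family closed under differentiation.\<close>

definition flat_exp :: "real poly \<Rightarrow> real \<Rightarrow> real"
  where "flat_exp P y = (if y > 0 then poly P (1 / y) * exp (- (1 / y)) else 0)"

lemma poly_times_exp_minus_tendsto_0:
  "((\<lambda>z. poly P z * exp (- z)) \<longlongrightarrow> (0::real)) at_top"
proof -
  have "((\<lambda>z::real. \<Sum>i\<le>degree P. coeff P i * (z ^ i / exp z)) \<longlongrightarrow> (\<Sum>i\<le>degree P. coeff P i * 0)) at_top"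
    by (intro tendsto_sum tendsto_mult_left tendsto_power_div_exp_0)
  moreover have "(\<Sum>i\<le>degree P. coeff P i * (z ^ i / exp z)) = poly P z * exp (- z)" for z
    unfolding poly_altdef exp_minus sum_distrib_right by (simp add: divide_inverse mult.assoc)
  ultimately show ?thesis by simp
qed

lemma flat_exp_tendsto_0: "(flat_exp P \<longlongrightarrow> 0) (at 0)"
proof (rule filterlim_split_at)
  have "eventually (\<lambda>y. flat_exp P y = 0) (at_left 0)"
    by (auto simp: flat_exp_def eventually_at_filter)
  then show "(flat_exp P \<longlongrightarrow> 0) (at_left 0)"
    by (rule tendsto_eventually)
  have "((\<lambda>y. poly P (inverse y) * exp (- (inverse y))) \<longlongrightarrow> 0) (at_right (0::real))"
    using filterlim_compose[OF poly_times_exp_minus_tendsto_0 filterlim_inverse_at_top_right] by simp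
  then show "(flat_exp P \<longlongrightarrow> 0) (at_right 0)"
    by (rule Lim_transform_eventually)
      (auto simp: flat_exp_def eventually_at_filter inverse_eq_divide)
qed

text \<open>Differentiating 1/y yields the factor 1/y^2, which is the polynomial
  \<open>[:0, 0, 1:]\<close> evaluated at 1/y; the exponential contributes \<open>P\<close> and the
  polynomial contributes \<open>- pderiv P\<close>.\<close>

lemma flat_exp_deriv:
  "(flat_exp P has_real_derivative flat_exp ([:0, 0, 1:] * (P - pderiv P)) y) (at y)"
proof -
  consider "y > 0" | "y < 0" | "y = 0" by linarith
  then show ?thesis
  proof cases
    case 1
    have inv: "((\<lambda>y. 1 / y) has_real_derivative - (1 / y\<^sup>2)) (at y)"
      using 1 by (auto intro!: derivative_eq_intros simp: power2_eq_square)
    have "((\<lambda>y. poly P (1 / y) * exp (- (1 / y))) has_real_derivative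
        poly (pderiv P) (1 / y) * (- (1 / y\<^sup>2)) * exp (- (1 / y))
          + exp (- (1 / y)) * (- (- (1 / y\<^sup>2))) * poly P (1 / y)) (at y)"
      by (rule DERIV_mult[OF DERIV_chain2[OF poly_DERIV inv]
            DERIV_chain2[OF DERIV_exp DERIV_minus[OF inv]]])
    moreover have "poly (pderiv P) (1 / y) * (- (1 / y\<^sup>2)) * exp (- (1 / y))
          + exp (- (1 / y)) * (- (- (1 / y\<^sup>2))) * poly P (1 / y)
        = flat_exp ([:0, 0, 1:] * (P - pderiv P)) y"
      using 1 by (simp add: flat_exp_def power2_eq_square algebra_simps)
    ultimately have "((\<lambda>y. poly P (1 / y) * exp (- (1 / y))) has_real_derivative
        flat_exp ([:0, 0, 1:] * (P - pderiv P)) y) (at y)"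
      by simp
    then show ?thesis
      by (rule has_field_derivative_transform_within_open[of _ _ _ "{0<..}"])
        (use 1 in \<open>auto simp: flat_exp_def\<close>)
  next
    case 2
    have "((\<lambda>_. 0) has_real_derivative 0) (at y)" by simp
    then have "(flat_exp P has_real_derivative 0) (at y)"
      by (rule has_field_derivative_transform_within_open[of _ _ _ "{..<0}"])
        (use 2 in \<open>auto simp: flat_exp_def\<close>)
    then show ?thesis using 2 by (simp add: flat_exp_def)
  next
    case 3
    \<comment> \<open>Dividing by \<open>h\<close> only raises the degree of the polynomial in 1/h,
      so the difference quotient at 0 is again a member of the family and tends to 0.\<close>
    have "flat_exp P h / h = flat_exp ([:0, 1:] * P) h" for h
      by (auto simp: flat_exp_def)
    then have "((\<lambda>h. flat_exp P h / h) \<longlongrightarrow> 0) (at 0)"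
      using flat_exp_tendsto_0[of "[:0, 1:] * P"] by presburger
    then show ?thesis
      using 3 by (simp add: DERIV_def flat_exp_def)
  qed
qed

lemma smooth_flat_exp: "smooth (flat_exp P)"
  by (rule smoothI_closed[of _ "range flat_exp"]) (use flat_exp_deriv in auto)

lemma test_functionsI:
  assumes "smooth \<phi>" "0 < a" "b < T" "\<And>x. x \<notin> {a..b} \<Longrightarrow> \<phi> x = 0"
  shows "\<phi> \<in> test_functions T"
  using assms unfolding test_functions_def smooth_def by blast

lemma test_functionsE:
  assumes "\<phi> \<in> test_functions T"
  obtains a b where "smooth \<phi>" "0 < a" "b < T" "\<And>x. x \<notin> {a..b} \<Longrightarrow> \<phi> x = 0"
  using assms unfolding test_functions_def smooth_def by blast

lemma test_functions_smooth: "\<phi> \<in> test_functions T \<Longrightarrow> smooth \<phi>"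
  by (auto elim: test_functionsE)

lemma test_functions_eq_0:
  "\<phi> \<in> test_functions T \<Longrightarrow> x \<le> 0 \<or> T \<le> x \<Longrightarrow> \<phi> x = 0"
  by (auto elim!: test_functionsE)

lemma test_functions_deriv:
  assumes "\<phi> \<in> test_functions T"
  shows "deriv \<phi> \<in> test_functions T"
  using assms
proof (rule test_functionsE)
  fix a b assume *: "smooth \<phi>" "0 < a" "b < T" "\<And>x. x \<notin> {a..b} \<Longrightarrow> \<phi> x = 0"
  have "deriv \<phi> x = 0" if "x \<notin> {a..b}" for x
  proof -
    have "((\<lambda>_. 0) has_real_derivative 0) (at x)" by simp
    then have "(\<phi> has_real_derivative 0) (at x)"
      by (rule has_field_derivative_transform_within_open[of _ _ _ "- {a..b}"])
        (use that * in \<open>auto intro: open_Compl\<close>)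
    then show ?thesis by (rule DERIV_imp_deriv)
  qed
  then show ?thesis
    using * smooth_deriv by (intro test_functionsI[of _ a b]) auto
qed

text \<open>Scaling by \<open>Suc n\<close> steepens both flanks while the support stays in [a,b]:
  the bumps tend boundedly to the indicator of the open interval, as dominated convergence
  requires.\<close>

definition bump :: "real \<Rightarrow> real \<Rightarrow> nat \<Rightarrow> real \<Rightarrow> real"
  where "bump a b n x = flat_exp 1 (real (Suc n) * (x - a)) * flat_exp 1 (real (Suc n) * (b - x))"

lemma bump_test_function:
  assumes "0 < a" "b < T"
  shows "bump a b n \<in> test_functions T"
proof (rule test_functionsI[OF _ assms])
  have "smooth (\<lambda>x. flat_exp 1 (real (Suc n) * x + (- real (Suc n) * a)) *
      flat_exp 1 (- real (Suc n) * x + real (Suc n) * b))"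
    by (rule smooth_mult[OF smooth_affine smooth_affine]) (rule smooth_flat_exp)+
  then show "smooth (bump a b n)"
    unfolding bump_def[abs_def] by (simp add: algebra_simps)
qed (auto simp: bump_def flat_exp_def zero_less_mult_iff)

lemma bump_nonneg: "0 \<le> bump a b n x"
  and bump_le_1: "bump a b n x \<le> 1"
  by (auto simp: bump_def flat_exp_def intro!: mult_le_one)

lemma bump_eq_0: "x \<notin> {a<..<b} \<Longrightarrow> bump a b n x = 0"
  by (auto simp: bump_def flat_exp_def zero_less_mult_iff)

lemma bump_neq_0: "bump a b n x \<noteq> 0 \<Longrightarrow> a < x \<and> x < b"
  using bump_eq_0 by fastforce

lemma flat_exp_scale_tendsto: "0 < y \<Longrightarrow> (\<lambda>n. flat_exp 1 (real (Suc n) * y)) \<longlonglongrightarrow> 1"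
proof -
  assume y: "0 < y"
  have "(\<lambda>n. exp (- (inverse (real (Suc n)) * (1 / y)))) \<longlonglongrightarrow> exp (- (0 * (1 / y)))"
    by (intro tendsto_intros LIMSEQ_inverse_real_of_nat)
  then show ?thesis
    using y by (simp add: flat_exp_def zero_less_mult_iff inverse_eq_divide del: of_nat_Suc)
qed

lemma bump_tendsto: "(\<lambda>n. bump a b n x) \<longlonglongrightarrow> indicator {a<..<b} x"
proof (cases "x \<in> {a<..<b}")
  case True
  then have "(\<lambda>n. bump a b n x) \<longlonglongrightarrow> 1 * 1"
    unfolding bump_def by (intro tendsto_mult flat_exp_scale_tendsto) auto
  then show ?thesis using True by simp
next
  case False
  then show ?thesis by (simp add: bump_eq_0)
qed

section \<open>The fundamental lemma of the calculus of variations\<close>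

text \<open>Dynkin's argument: the rays are stable under intersection and generate the Borel sets,
  and the sets over which \<open>g\<close> integrates to 0 form a Dynkin system. The hypothesis
  \<open>total\<close> handles complements, since the whole line is not a ray.\<close>

lemma AE_eq_0_if_integral_rays_eq_0:
  fixes g :: "real \<Rightarrow> real"
  assumes g: "integrable lborel g"
    and total: "(\<integral>x. g x \<partial>lborel) = 0"
    and rays: "\<And>a. (LINT x:{a<..}|lborel. g x) = 0"
  shows "AE x in lborel. g x = 0"
proof (rule sigma_finite_measure.density_zero[OF sigma_finite_lborel g])
  have set_int: "set_integrable lborel A g" if "A \<in> sets borel" for A
    using that g unfolding set_integrable_def by (intro integrable_mult_indicator) auto
  have eq: "sets (borel :: real measure) = sigma_sets UNIV (range greaterThan)"
    by (subst borel_Ioi) (simp add: sets_measure_of)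
  have stable: "Int_stable (range (greaterThan :: real \<Rightarrow> real set))"
    unfolding Int_stable_def
  proof (intro ballI)
    fix A B :: "real set" assume "A \<in> range greaterThan" "B \<in> range greaterThan"
    then obtain a b where "A = {a<..}" "B = {b<..}" by blast
    then have "A \<inter> B = {max a b<..}" by auto
    then show "A \<inter> B \<in> range greaterThan" by blast
  qed
  fix A assume "A \<in> sets (lborel :: real measure)"
  then have "A \<in> sigma_sets UNIV (range greaterThan)"
    using eq by simp
  with stable subset_UNIV[of "range greaterThan", folded Pow_UNIV]
  show "(LINT x:A|lborel. g x) = 0"
  proof (induction rule: sigma_sets_induct_disjoint)
    case (compl A)
    then have "A \<in> sets borel" using eq by simp
    have "(LINT x:UNIV - A|lborel. g x) = (\<integral>x. g x - indicator A x *\<^sub>R g x \<partial>lborel)"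
      unfolding set_lebesgue_integral_def
      by (rule Bochner_Integration.integral_cong) (auto simp: indicator_def)
    also have "\<dots> = (\<integral>x. g x \<partial>lborel) - (LINT x:A|lborel. g x)"
      unfolding set_lebesgue_integral_def
      using g set_int[OF \<open>A \<in> sets borel\<close>]
      by (intro Bochner_Integration.integral_diff) (auto simp: set_integrable_def)
    finally show ?case using total compl by simp
  next
    case (union A)
    then have A: "range A \<subseteq> sets borel" using eq by simp
    then have "(LINT x:(\<Union>i. A i)|lborel. g x) = (\<Sum>i. LINT x:A i|lborel. g x)"
      using union by (intro lebesgue_integral_countable_add set_int)
        (auto simp: disjoint_family_on_def)
    then show ?case using union by simp
  qed (use rays in \<open>auto simp: set_lebesgue_integral_def\<close>)
qed

text \<open>A Lebesgue measurable function agrees almost everywhere with a Borel measurable one, and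
  passing to it changes none of the integrals.\<close>

lemma AE_eq_0_if_integral_rays_eq_0_lebesgue:
  fixes g :: "real \<Rightarrow> real"
  assumes g: "integrable lebesgue g"
    and total: "(\<integral>x. g x \<partial>lebesgue) = 0"
    and rays: "\<And>a. (LINT x:{a<..}|lebesgue. g x) = 0"
  shows "AE x in lebesgue. g x = 0"
proof -
  obtain g' where g'[measurable]: "g' \<in> borel_measurable lborel" and eq: "AE x in lborel. g x = g' x"
    using completion_ex_borel_measurable_real[OF borel_measurable_integrable[OF g]] by auto
  have eq': "AE x in lebesgue. g x = g' x" using eq by (rule AE_completion)
  have [measurable]: "g \<in> borel_measurable lebesgue" using g by auto
  have [measurable]: "g' \<in> borel_measurable lebesgue" using g' by (rule measurable_completion)
  have "integrable lebesgue g'" using g eq' by (subst integrable_cong_AE[symmetric]) auto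
  then have int: "integrable lborel g'" by (simp add: integrable_completion)
  have trans: "(LINT x:A|lborel. g' x) = (LINT x:A|lebesgue. g x)" if [measurable]: "A \<in> sets borel" for A
  proof -
    have [measurable]: "A \<in> sets lebesgue" by (simp add: that)
    have "(LINT x:A|lborel. g' x) = (LINT x:A|lebesgue. g' x)"
      unfolding set_lebesgue_integral_def by (subst integral_completion) auto
    also have "\<dots> = (LINT x:A|lebesgue. g x)"
      unfolding set_lebesgue_integral_def using eq' by (intro integral_cong_AE) auto
    finally show ?thesis .
  qed
  have "AE x in lborel. g' x = 0"
  proof (rule AE_eq_0_if_integral_rays_eq_0[OF int])
    show "(\<integral>x. g' x \<partial>lborel) = 0"
      using trans[of UNIV] total by (simp add: set_lebesgue_integral_def)
  qed (use trans rays in auto)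
  then have "AE x in lborel. g x = 0" using eq by eventually_elim simp
  then show ?thesis by (rule AE_completion)
qed

text \<open>The bumps for (a,b) are test functions converging to its indicator. Since
  \<open>g\<close> is only locally integrable, the dominating function is its truncation
  \<open>G\<close> to [a,b].\<close>

lemma L1_loc_bump_integral:
  assumes g: "g \<in> L1_loc T" and ab: "0 < a" "b < T"
    and zero: "\<And>\<phi>. \<phi> \<in> test_functions T \<Longrightarrow> (\<integral>t. g t * \<phi> t \<partial>leb T) = 0"
  shows "(\<integral>x. indicator {a<..<b} x * g x \<partial>lebesgue) = 0"
proof -
  define G where "G = (\<lambda>x. indicator {a..b} x * g x)"
  have G: "integrable lebesgue G"
    using g ab by (auto simp: L1_loc_def set_integrable_def G_def)
  then have [measurable]: "G \<in> borel_measurable lebesgue" by auto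
  have [measurable]: "bump a b n \<in> borel_measurable lebesgue" for n
    using test_functions_smooth[OF bump_test_function[OF ab]]
    by (auto intro!: measurable_completion borel_measurable_continuous_onI smooth_continuous)
  have "(\<integral>x. G x * bump a b n x \<partial>lebesgue) = (\<integral>t. g t * bump a b n t \<partial>leb T)" for n
    by (subst integral_restrict_space)
      (use ab in \<open>auto intro!: Bochner_Integration.integral_cong simp: G_def indicator_def
        dest!: bump_neq_0\<close>)
  then have z: "(\<integral>x. G x * bump a b n x \<partial>lebesgue) = 0" for n
    using zero[OF bump_test_function[OF ab]] by simp
  have "(\<lambda>n. \<integral>x. G x * bump a b n x \<partial>lebesgue) \<longlonglongrightarrow> (\<integral>x. G x * indicator {a<..<b} x \<partial>lebesgue)"
  proof (rule integral_dominated_convergence[where w = "\<lambda>x. \<bar>G x\<bar>"])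
    show "AE x in lebesgue. (\<lambda>n. G x * bump a b n x) \<longlonglongrightarrow> G x * indicator {a<..<b} x"
      by (intro AE_I2 tendsto_mult tendsto_const bump_tendsto)
    show "AE x in lebesgue. norm (G x * bump a b n x) \<le> \<bar>G x\<bar>" for n
      by (auto simp: abs_mult bump_nonneg bump_le_1 mult_left_le)
  qed (use G in \<open>auto intro!: borel_measurable_times borel_measurable_indicator\<close>)
  then have "(\<integral>x. G x * indicator {a<..<b} x \<partial>lebesgue) = 0"
    using z by (simp add: LIMSEQ_const_iff)
  then show ?thesis
    by (subst (asm) Bochner_Integration.integral_cong[OF refl, of _ _ "\<lambda>x. indicator {a<..<b} x * g x"])
      (auto simp: G_def indicator_def)
qed

lemma fundamental_lemma_of_variations:
  assumes g: "g \<in> L1_loc T"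
    and zero: "\<And>\<phi>. \<phi> \<in> test_functions T \<Longrightarrow> (\<integral>t. g t * \<phi> t \<partial>leb T) = 0"
  shows "AE t in leb T. g t = 0"
proof -
  have local: "AE x in lebesgue. x \<in> {A<..<B} \<longrightarrow> g x = 0" if AB: "0 < A" "B < T" for A B
  proof -
    define G where "G = (\<lambda>x. indicator {A<..<B} x * g x)"
    have "set_integrable lebesgue {A<..<B} g"
      by (rule set_integrable_subset[of _ "{A..B}"]) (use g AB in \<open>auto simp: L1_loc_def\<close>)
    then have G: "integrable lebesgue G"
      by (simp add: set_integrable_def G_def)
    have "AE x in lebesgue. G x = 0"
    proof (rule AE_eq_0_if_integral_rays_eq_0_lebesgue[OF G])
      show "(\<integral>x. G x \<partial>lebesgue) = 0"
        using L1_loc_bump_integral[OF g AB zero] by (simp add: G_def)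
      fix a
      \<comment> \<open>A ray cuts the window (A,B) in another open interval, possibly empty, that
        keeps its distance from 0 and T, so the bump integrals apply to it.\<close>
      have "(LINT x:{a<..}|lebesgue. G x) = (\<integral>x. indicator {max a A<..<B} x * g x \<partial>lebesgue)"
        unfolding set_lebesgue_integral_def
        by (rule Bochner_Integration.integral_cong) (auto simp: G_def indicator_def)
      also have "\<dots> = 0"
        using AB by (intro L1_loc_bump_integral[OF g _ _ zero]) auto
      finally show "(LINT x:{a<..}|lebesgue. G x) = 0" .
    qed
    then show ?thesis by eventually_elim (auto simp: G_def indicator_def)
  qed
  \<comment> \<open>Countably many windows exhaust (0,T), so the exceptional null sets can be
    united.\<close>
  have "AE x in lebesgue. \<forall>n. x \<in> {inverse (real (Suc n))<..<T - inverse (real (Suc n))} \<longrightarrow> g x = 0"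
    by (subst AE_all_countable) (intro allI local, auto)
  then have "AE x in lebesgue. x \<in> {0<..<T} \<longrightarrow> g x = 0"
  proof eventually_elim
    case (elim x)
    show ?case
    proof
      assume "x \<in> {0<..<T}"
      then obtain n where "inverse (real (Suc n)) < min x (T - x)"
        using reals_Archimedean[of "min x (T - x)"] by auto
      then show "g x = 0" using elim[rule_format, of n] by auto
    qed
  qed
  then show ?thesis by (simp add: AE_restrict_space_iff)
qed

section \<open>Absolutely continuous functions\<close>

lemma finite_measure_leb: "finite_measure (leb T)"
  by (rule finite_measure_lebesgue_on) simp

lemma measurable_leb_of_borel: "f \<in> borel_measurable borel \<Longrightarrow> f \<in> borel_measurable (leb T)"
  by (intro measurable_restrict_space1 measurable_completion) simp

lemma measurable_leb_continuous:
  fixes f :: "real \<Rightarrow> real"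
  assumes "continuous_on {0..T} f"
  shows "f \<in> borel_measurable (leb T)"
  by (rule continuous_imp_measurable_on_sets_lebesgue)
    (use assms in \<open>auto intro: continuous_on_subset\<close>)

lemma continuous_bounded_interval:
  fixes f :: "real \<Rightarrow> real"
  assumes "continuous_on {0..T} f"
  obtains B where "\<And>t. t \<in> {0..T} \<Longrightarrow> \<bar>f t\<bar> \<le> B"
proof -
  have "bounded (f ` {0..T})"
    using assms by (intro compact_imp_bounded compact_continuous_image) auto
  then show thesis by (metis that bounded_iff imageI real_norm_def)
qed

lemma integrable_leb_mult_continuous:
  fixes f g :: "real \<Rightarrow> real"
  assumes f: "continuous_on {0..T} f" and g: "integrable (leb T) g"
  shows "integrable (leb T) (\<lambda>t. f t * g t)" "integrable (leb T) (\<lambda>t. g t * f t)"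
proof -
  obtain B where B: "\<And>t. t \<in> {0..T} \<Longrightarrow> \<bar>f t\<bar> \<le> B"
    using continuous_bounded_interval[OF f] by blast
  have [measurable]: "f \<in> borel_measurable (leb T)" "g \<in> borel_measurable (leb T)"
    using measurable_leb_continuous[OF f] g by auto
  show "integrable (leb T) (\<lambda>t. f t * g t)"
  proof (rule Bochner_Integration.integrable_bound)
    show "integrable (leb T) (\<lambda>t. B * g t)" using g by simp
    show "AE t in leb T. norm (f t * g t) \<le> norm (B * g t)"
    proof (rule AE_I2)
      fix t assume "t \<in> space (leb T)"
      then have "\<bar>f t\<bar> \<le> \<bar>B\<bar>" using B[of t] by auto
      then show "norm (f t * g t) \<le> norm (B * g t)"
        by (simp add: abs_mult mult_right_mono)
    qed
  qed simp
  then show "integrable (leb T) (\<lambda>t. g t * f t)" by (simp add: mult.commute)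
qed

lemma integrable_leb_continuous: "continuous_on {0..T} f \<Longrightarrow> integrable (leb T) f"
  for f :: "real \<Rightarrow> real"
  using integrable_leb_mult_continuous(1)[of T f "\<lambda>_. 1"]
  by (simp add: finite_measure.integrable_const[OF finite_measure_leb])

lemma AE_leb_neq: "AE s in leb T. s \<noteq> t"
  by (subst AE_restrict_space_iff)
    (auto intro: eventually_mono[OF AE_completion[OF AE_lborel_singleton]])

text \<open>The integral from 0 to t, written over a fixed measure with a moving indicator: it is
  defined for every real t and is amenable to dominated convergence and Fubini.\<close>

definition primitive :: "real \<Rightarrow> (real \<Rightarrow> real) \<Rightarrow> real \<Rightarrow> real"
  where "primitive T v t = (\<integral>s. indicator {..t} s * v s \<partial>leb T)"

lemma integrable_leb_indicator:
  fixes v :: "real \<Rightarrow> real"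
  assumes "integrable (leb T) v"
  shows "integrable (leb T) (\<lambda>s. indicator {..t} s * v s)"
proof -
  have [measurable]: "v \<in> borel_measurable (leb T)" using assms by auto
  have "(\<lambda>s. indicator {..t} s * v s) \<in> borel_measurable (leb T)"
    by (rule borel_measurable_times[OF measurable_leb_of_borel]) auto
  then show ?thesis
    by (rule Bochner_Integration.integrable_bound[OF assms]) (auto simp: indicator_def)
qed

lemma primitive_0: "primitive T v 0 = 0"
  unfolding primitive_def by (rule integral_eq_zero_AE) (auto simp: indicator_def intro!: AE_I2)

lemma primitive_T: "primitive T v T = (\<integral>s. v s \<partial>leb T)"
  unfolding primitive_def by (rule Bochner_Integration.integral_cong) (auto simp: indicator_def)

text \<open>Dominated convergence: as the endpoint moves to t, the indicators converge at every s
  except possibly s = t, which is a null set.\<close>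

lemma primitive_continuous:
  assumes v: "integrable (leb T) v"
  shows "continuous_on A (primitive T v)"
proof -
  have "isCont (primitive T v) t" for t
    unfolding continuous_at_sequentially comp_def
  proof (intro allI impI)
    fix x :: "nat \<Rightarrow> real" assume x: "x \<longlonglongrightarrow> t"
    show "(\<lambda>n. primitive T v (x n)) \<longlonglongrightarrow> primitive T v t"
      unfolding primitive_def
    proof (rule integral_dominated_convergence[where w = "\<lambda>s. \<bar>v s\<bar>"])
      show "AE s in leb T. (\<lambda>n. indicator {..x n} s * v s) \<longlonglongrightarrow> indicator {..t} s * v s"
        using AE_leb_neq[where T = T and t = t]
      proof eventually_elim
        case (elim s)
        have "eventually (\<lambda>n. indicator {..x n} s * v s = indicator {..t} s * v s) sequentially"
        proof (cases "s < t")
          case True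
          then have "eventually (\<lambda>n. s < x n) sequentially" using x by (simp add: order_tendsto_iff)
          then show ?thesis by (rule eventually_mono) (use True in \<open>auto simp: indicator_def\<close>)
        next
          case False
          then have "eventually (\<lambda>n. x n < s) sequentially" using x elim by (simp add: order_tendsto_iff)
          then show ?thesis by (rule eventually_mono) (use False elim in \<open>auto simp: indicator_def\<close>)
        qed
        then show ?case by (rule tendsto_eventually)
      qed
      show "AE s in leb T. norm (indicator {..x n} s * v s) \<le> \<bar>v s\<bar>" for n
        by (auto simp: indicator_def)
      show "integrable (leb T) (\<lambda>s. \<bar>v s\<bar>)" using v by simp
    qed (intro borel_measurable_integrable integrable_leb_indicator v)+
  qed
  then show ?thesis by (simp add: continuous_at_imp_continuous_on)
qed

lemma primitive_add:
  "integrable (leb T) v \<Longrightarrow> integrable (leb T) w \<Longrightarrow> primitive T (\<lambda>s. v s + w s) t = primitive T v t + primitive T w t"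
  unfolding primitive_def
  by (simp add: distrib_left Bochner_Integration.integral_add integrable_leb_indicator)

lemma primitive_scale: "primitive T (\<lambda>s. c * v s) t = c * primitive T v t"
  unfolding primitive_def by (simp add: mult.left_commute)

text \<open>The product rule by Fubini: the product of the two integrals is a double integral over a
  square, which the diagonal cuts into two triangles. Integrating each triangle along its inner
  variable gives one summand.\<close>

lemma primitive_mult:
  assumes v: "integrable (leb T) v" and w: "integrable (leb T) w"
  shows "primitive T v t * primitive T w t = primitive T (\<lambda>s. v s * primitive T w s + w s * primitive T v s) t"
proof -
  define M where "M = leb T"
  interpret M: finite_measure M unfolding M_def by (rule finite_measure_leb)
  interpret P: pair_sigma_finite M M ..
  define v' where "v' = (\<lambda>s. indicator {..t} s * v s)"
  define w' where "w' = (\<lambda>s. indicator {..t} s * w s)"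
  define K where "K = (\<lambda>x y. of_bool (x \<le> y) * (v' x * w' y))"
  have v': "integrable M v'" and w': "integrable M w'"
    unfolding v'_def w'_def M_def by (intro integrable_leb_indicator v w)+
  then have [measurable]: "v' \<in> borel_measurable M" "w' \<in> borel_measurable M" by auto
  have [measurable]: "(\<lambda>x. x) \<in> borel_measurable M"
    unfolding M_def by (rule measurable_leb_of_borel) simp
  have Kmeas: "case_prod K \<in> borel_measurable (M \<Otimes>\<^sub>M M)"
    unfolding K_def by measurable
  have prodI: "integrable (M \<Otimes>\<^sub>M M) (\<lambda>(x, y). v' x * w' y)"
  proof (rule P.Fubini_integrable)
    have "integrable M (\<lambda>x. norm (v' x) * (\<integral>y. norm (w' y) \<partial>M))"
      using v' by (intro integrable_mult_left) simp
    then show "integrable M (\<lambda>x. \<integral>y. norm (case (x, y) of (x, y) \<Rightarrow> v' x * w' y) \<partial>M)"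
      by (simp add: abs_mult)
    show "AE x in M. integrable M (\<lambda>y. case (x, y) of (x, y) \<Rightarrow> v' x * w' y)"
      using w' by simp
  qed measurable
  have KI: "integrable (M \<Otimes>\<^sub>M M) (case_prod K)"
    by (rule Bochner_Integration.integrable_bound[OF prodI Kmeas]) (auto simp: K_def)
  have vle: "(\<integral>x. of_bool (x \<le> y) * v' x \<partial>M) = primitive T v y" if "y \<le> t" for y
    unfolding primitive_def M_def[symmetric]
    by (rule Bochner_Integration.integral_cong) (use that in \<open>auto simp: v'_def indicator_def\<close>)
  \<comment> \<open>\<open>K\<close> takes the triangle that contains the diagonal, so the other one
    is y < x; it differs from the closed ray in \<open>primitive\<close> by the single point y =
    x.\<close>
  have wless: "(\<integral>y. (1 - of_bool (x \<le> y)) * w' y \<partial>M) = primitive T w x" if "x \<le> t" for x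
    unfolding primitive_def M_def[symmetric]
  proof (rule integral_cong_AE)
    show "AE y in M. (1 - of_bool (x \<le> y)) * w' y = indicator {..x} y * w y"
      using AE_leb_neq[where T = T and t = x] unfolding M_def
      by eventually_elim (use that in \<open>auto simp: w'_def indicator_def\<close>)
    show "(\<lambda>y. indicator {..x} y * w y) \<in> borel_measurable M"
      using integrable_leb_indicator[OF w] unfolding M_def by auto
  qed measurable
  have slice: "integrable M (\<lambda>y. of_bool (x \<le> y) * w' y)" for x
    by (rule Bochner_Integration.integrable_bound[OF w']) auto
  have split: "(\<integral>y. K x y \<partial>M) = v' x * (\<integral>y. w' y \<partial>M) - v' x * primitive T w x" for x
  proof (cases "x \<le> t")
    case True
    have "(\<integral>y. of_bool (x \<le> y) * w' y \<partial>M) = (\<integral>y. w' y \<partial>M) - (\<integral>y. (1 - of_bool (x \<le> y)) * w' y \<partial>M)"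
      using w' slice by (subst Bochner_Integration.integral_diff[symmetric])
        (auto simp: left_diff_distrib)
    then have "(\<integral>y. of_bool (x \<le> y) * w' y \<partial>M) = (\<integral>y. w' y \<partial>M) - primitive T w x"
      using wless[OF True] by simp
    moreover have "K x = (\<lambda>y. v' x * (of_bool (x \<le> y) * w' y))"
      by (auto simp: K_def)
    ultimately show ?thesis by (simp add: right_diff_distrib)
  next
    case False
    then show ?thesis by (simp add: K_def v'_def)
  qed
  have wv: "integrable M (\<lambda>s. w' s * primitive T v s)" and vw: "integrable M (\<lambda>s. v' s * primitive T w s)"
    using v' w' unfolding M_def
    by (auto intro: integrable_leb_mult_continuous(2)[OF primitive_continuous[OF v]]
        integrable_leb_mult_continuous(2)[OF primitive_continuous[OF w]])
  have "(\<integral>y. \<integral>x. K x y \<partial>M \<partial>M) = (\<integral>s. w' s * primitive T v s \<partial>M)"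
  proof (rule Bochner_Integration.integral_cong)
    fix y
    show "(\<integral>x. K x y \<partial>M) = w' y * primitive T v y"
    proof (cases "y \<le> t")
      case True
      have "(\<lambda>x. K x y) = (\<lambda>x. w' y * (of_bool (x \<le> y) * v' x))" by (auto simp: K_def)
      then show ?thesis using vle[OF True] by simp
    qed (simp add: K_def w'_def)
  qed simp
  moreover have "(\<integral>x. \<integral>y. K x y \<partial>M \<partial>M) = (\<integral>x. v' x \<partial>M) * (\<integral>y. w' y \<partial>M) - (\<integral>s. v' s * primitive T w s \<partial>M)"
    unfolding split using v' vw by (subst Bochner_Integration.integral_diff) auto
  ultimately have "(\<integral>x. v' x \<partial>M) * (\<integral>y. w' y \<partial>M)
      = (\<integral>s. v' s * primitive T w s \<partial>M) + (\<integral>s. w' s * primitive T v s \<partial>M)"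
    using P.Fubini_integral[OF KI] by simp
  also have "\<dots> = (\<integral>s. v' s * primitive T w s + w' s * primitive T v s \<partial>M)"
    using vw wv by simp
  also have "\<dots> = primitive T (\<lambda>s. v s * primitive T w s + w s * primitive T v s) t"
    unfolding primitive_def[of T "\<lambda>s. v s * primitive T w s + w s * primitive T v s"] M_def[symmetric]
    by (rule Bochner_Integration.integral_cong) (auto simp: v'_def w'_def algebra_simps)
  finally show ?thesis
    unfolding primitive_def[of T v t] primitive_def[of T w t] M_def[symmetric] v'_def[symmetric] w'_def[symmetric] .
qed

text \<open>Absolute continuity on [0,T], encoded by the fundamental theorem of calculus. The
  derivative is carried as an argument and matters only up to null sets, so no pointwise
  differentiability is involved.\<close>

definition abs_cont :: "real \<Rightarrow> (real \<Rightarrow> real) \<Rightarrow> (real \<Rightarrow> real) \<Rightarrow> bool"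
  where "abs_cont T g v \<longleftrightarrow> integrable (leb T) v \<and> (\<forall>t\<in>{0..T}. g t = g 0 + primitive T v t)"

lemma abs_cont_integrable: "abs_cont T g v \<Longrightarrow> integrable (leb T) v"
  unfolding abs_cont_def by blast

lemma abs_cont_eq: "abs_cont T g v \<Longrightarrow> t \<in> {0..T} \<Longrightarrow> g t = g 0 + primitive T v t"
  unfolding abs_cont_def by blast

lemma abs_cont_continuous:
  assumes "abs_cont T g v"
  shows "continuous_on {0..T} g"
proof -
  have "continuous_on {0..T} (\<lambda>t. g 0 + primitive T v t)"
    by (intro continuous_on_add continuous_on_const primitive_continuous abs_cont_integrable[OF assms])
  then show ?thesis
    by (rule continuous_on_eq) (rule abs_cont_eq[OF assms, symmetric])
qed

lemma abs_cont_integral: "abs_cont T g v \<Longrightarrow> 0 \<le> T \<Longrightarrow> (\<integral>t. v t \<partial>leb T) = g T - g 0"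
  by (simp add: abs_cont_eq[of T g v T] primitive_T)

lemma abs_cont_primitive: "integrable (leb T) v \<Longrightarrow> abs_cont T (\<lambda>t. c + primitive T v t) v"
  by (simp add: abs_cont_def primitive_0)

lemma abs_cont_add:
  assumes g: "abs_cont T g v" and h: "abs_cont T h w"
  shows "abs_cont T (\<lambda>t. g t + h t) (\<lambda>t. v t + w t)"
  unfolding abs_cont_def
proof (intro conjI ballI)
  note I = abs_cont_integrable[OF g] abs_cont_integrable[OF h]
  show "integrable (leb T) (\<lambda>t. v t + w t)" using I by simp
  fix t assume "t \<in> {0..T}"
  then show "g t + h t = g 0 + h 0 + primitive T (\<lambda>t. v t + w t) t"
    using abs_cont_eq[OF g, of t] abs_cont_eq[OF h, of t] primitive_add[OF I, of t] by linarith
qed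

lemma abs_cont_scale:
  assumes g: "abs_cont T g v"
  shows "abs_cont T (\<lambda>t. c * g t) (\<lambda>t. c * v t)"
  unfolding abs_cont_def
proof (intro conjI ballI)
  show "integrable (leb T) (\<lambda>t. c * v t)" using abs_cont_integrable[OF g] by simp
  fix t assume "t \<in> {0..T}"
  then have "c * g t = c * (g 0 + primitive T v t)" using abs_cont_eq[OF g, of t] by presburger
  then show "c * g t = c * g 0 + primitive T (\<lambda>t. c * v t) t"
    unfolding primitive_scale by (simp only: distrib_left)
qed

lemma abs_cont_diff: "abs_cont T g v \<Longrightarrow> abs_cont T h w \<Longrightarrow> abs_cont T (\<lambda>t. g t - h t) (\<lambda>t. v t - w t)"
  using abs_cont_add[OF _ abs_cont_scale[of T h w "-1"]] by simp

lemma primitive_cong: "(\<And>s. s \<in> {0<..<T} \<Longrightarrow> v s = w s) \<Longrightarrow> primitive T v t = primitive T w t"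
  unfolding primitive_def by (rule Bochner_Integration.integral_cong) auto

text \<open>Writing each factor as its value at 0 plus a primitive leaves
  \<open>primitive_mult\<close> as the only term that is not linear.\<close>

lemma abs_cont_mult:
  assumes g: "abs_cont T g v" and h: "abs_cont T h w"
  shows "abs_cont T (\<lambda>t. g t * h t) (\<lambda>t. v t * h t + w t * g t)"
proof -
  note I = abs_cont_integrable[OF g] abs_cont_integrable[OF h]
  note C = abs_cont_continuous[OF g] abs_cont_continuous[OF h]
  have J: "integrable (leb T) (\<lambda>s. v s * primitive T w s)" "integrable (leb T) (\<lambda>s. w s * primitive T v s)"
    by (rule integrable_leb_mult_continuous(2)[OF primitive_continuous], rule I, rule I)+
  have "g t * h t = g 0 * h 0 + primitive T (\<lambda>t. v t * h t + w t * g t) t" if t: "t \<in> {0..T}" for t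
  proof -
    have "g t * h t = (g 0 + primitive T v t) * (h 0 + primitive T w t)"
      by (simp only: abs_cont_eq[OF g t] abs_cont_eq[OF h t])
    also have "\<dots> = g 0 * h 0 + (h 0 * primitive T v t + g 0 * primitive T w t + primitive T v t * primitive T w t)"
      by (simp add: algebra_simps)
    also have "h 0 * primitive T v t + g 0 * primitive T w t + primitive T v t * primitive T w t
        = primitive T (\<lambda>s. (h 0 * v s + g 0 * w s) + (v s * primitive T w s + w s * primitive T v s)) t"
      using I J by (simp add: primitive_add primitive_scale primitive_mult)
    also have "\<dots> = primitive T (\<lambda>t. v t * h t + w t * g t) t"
    proof (rule primitive_cong)
      fix s assume "s \<in> {0<..<T}"
      then have "s \<in> {0..T}" by auto
      then show "(h 0 * v s + g 0 * w s) + (v s * primitive T w s + w s * primitive T v s) = v s * h s + w s * g s"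
        by (simp add: abs_cont_eq[OF g, of s] abs_cont_eq[OF h, of s] algebra_simps)
    qed
    finally show ?thesis .
  qed
  moreover have "integrable (leb T) (\<lambda>t. v t * h t + w t * g t)"
    by (intro Bochner_Integration.integrable_add integrable_leb_mult_continuous(2) I C)
  ultimately show ?thesis
    unfolding abs_cont_def by blast
qed

lemma abs_cont_C1:
  fixes f :: "real \<Rightarrow> real"
  assumes T: "0 \<le> T" and f: "\<And>t. (f has_real_derivative f' t) (at t)" and cont: "continuous_on UNIV f'"
  shows "abs_cont T f f'"
proof -
  have "f t = f 0 + primitive T f' t" if t: "t \<in> {0..T}" for t
  proof -
    have meas: "f' \<in> borel_measurable borel" using cont by (rule borel_measurable_continuous_onI)
    have "f t - f 0 = (\<integral>s. indicator {0..t} s *\<^sub>R f' s \<partial>lborel)"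
      by (rule integral_FTC_atLeastAtMost[symmetric])
        (use t f cont in \<open>auto intro: has_vector_derivative_at_within continuous_on_subset
          has_field_derivative_at_within simp flip: has_real_derivative_iff_has_vector_derivative\<close>)
    also have "\<dots> = (\<integral>s. indicator {0..t} s *\<^sub>R f' s \<partial>lebesgue)"
      using meas by (intro integral_completion[symmetric]) measurable
    also have "\<dots> = (\<integral>s. indicator {0<..<T} s *\<^sub>R (indicator {..t} s * f' s) \<partial>lebesgue)"
    proof (rule integral_cong_AE)
      have *: "AE s in lebesgue. s \<noteq> x" for x :: real
        by (rule AE_completion[OF AE_lborel_singleton])
      show "AE s in lebesgue. indicator {0..t} s *\<^sub>R f' s = indicator {0<..<T} s *\<^sub>R (indicator {..t} s * f' s)"
        using *[of 0] *[of T] by eventually_elim (use t in \<open>auto simp: indicator_def\<close>)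
    qed (use meas in \<open>auto intro!: measurable_completion\<close>)
    also have "\<dots> = primitive T f' t"
      unfolding primitive_def by (subst integral_restrict_space) auto
    finally show ?thesis by simp
  qed
  moreover have "integrable (leb T) f'"
    using cont by (intro integrable_leb_continuous) (auto intro: continuous_on_subset)
  ultimately show ?thesis unfolding abs_cont_def by blast
qed

section \<open>Weak derivatives on an interval\<close>

text \<open>Completeness of Lebesgue measure. It allows chosen representatives to be exchanged
  freely for almost everywhere equal functions.\<close>

lemma measurable_leb_AE:
  fixes f g :: "real \<Rightarrow> real"
  assumes f: "f \<in> borel_measurable (leb T)" and eq: "AE t in leb T. f t = g t"
  shows "g \<in> borel_measurable (leb T)"
proof -
  have "(\<lambda>t. if t \<in> {0<..<T} then f t else 0) \<in> borel_measurable lebesgue"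
    using borel_measurable_if_I[OF f] by simp
  moreover have "AE t in lebesgue. (if t \<in> {0<..<T} then f t else 0) = (if t \<in> {0<..<T} then g t else 0)"
    using eq by (simp add: AE_restrict_space_iff)
  ultimately have "(\<lambda>t. if t \<in> {0<..<T} then g t else 0) \<in> borel_measurable lebesgue"
    by (rule borel_measurable_AE)
  then show ?thesis by (rule borel_measurable_if_D)
qed

lemma integrable_leb_iff: "integrable (leb T) v \<longleftrightarrow> set_integrable lebesgue {0<..<T} v"
  for v :: "real \<Rightarrow> real"
  unfolding set_integrable_def by (rule integrable_restrict_space) simp

lemma L1_loc_integrable: "integrable (leb T) v \<Longrightarrow> v \<in> L1_loc T"
  unfolding L1_loc_def integrable_leb_iff by (auto intro: set_integrable_subset)

lemma L1_loc_diff: "u \<in> L1_loc T \<Longrightarrow> v \<in> L1_loc T \<Longrightarrow> (\<lambda>t. u t - v t) \<in> L1_loc T"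
  unfolding L1_loc_def by (auto intro: set_integral_diff(1))

lemma test_functions_continuous: "\<phi> \<in> test_functions T \<Longrightarrow> continuous_on A \<phi>"
  by (simp add: smooth_continuous test_functions_smooth)

lemma L1_loc_mult_test_integrable:
  assumes u: "u \<in> L1_loc T" and \<phi>: "\<phi> \<in> test_functions T"
  shows "integrable (leb T) (\<lambda>t. u t * \<phi> t)"
  using \<phi>
proof (rule test_functionsE)
  fix a b assume ab: "0 < a" "b < T" "\<And>x. x \<notin> {a..b} \<Longrightarrow> \<phi> x = 0"
  define v where "v = (\<lambda>t. indicator {a..b} t * u t)"
  have "integrable lebesgue v"
    using u ab by (auto simp: L1_loc_def set_integrable_def v_def)
  then have "integrable (leb T) v"
    unfolding integrable_leb_iff set_integrable_def by (intro integrable_mult_indicator) auto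
  then have "integrable (leb T) (\<lambda>t. v t * \<phi> t)"
    by (rule integrable_leb_mult_continuous(2)[OF test_functions_continuous[OF \<phi>]])
  moreover have "v t * \<phi> t = u t * \<phi> t" for t
    using ab(3)[of t] by (auto simp: v_def indicator_def)
  ultimately show ?thesis by simp
qed

text \<open>This makes the arbitrary choice in \<open>wderiv\<close> harmless: any weak derivative
  at hand may replace the chosen one almost everywhere.\<close>

lemma has_weak_deriv_unique:
  assumes v: "has_weak_deriv T k u v" and w: "has_weak_deriv T k u w"
  shows "AE t in leb T. v t = w t"
proof -
  have L: "v \<in> L1_loc T" "w \<in> L1_loc T"
    using v w by (auto simp: has_weak_deriv_def)
  have "AE t in leb T. v t - w t = 0"
  proof (rule fundamental_lemma_of_variations[OF L1_loc_diff[OF L]])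
    fix \<phi> assume \<phi>: "\<phi> \<in> test_functions T"
    have "(-1) ^ k * (\<integral>t. v t * \<phi> t \<partial>leb T) = (-1) ^ k * (\<integral>t. w t * \<phi> t \<partial>leb T)"
      by (rule trans[OF sym]) (use v w \<phi> in \<open>auto simp: has_weak_deriv_def\<close>)
    then have "(\<integral>t. v t * \<phi> t \<partial>leb T) = (\<integral>t. w t * \<phi> t \<partial>leb T)" by simp
    then show "(\<integral>t. (v t - w t) * \<phi> t \<partial>leb T) = 0"
      using L1_loc_mult_test_integrable[OF _ \<phi>] L by (simp add: left_diff_distrib)
  qed
  then show ?thesis by simp
qed

lemma has_weak_deriv_wderiv: "has_weak_deriv T k u v \<Longrightarrow> has_weak_deriv T k u (wderiv T k u)"
  unfolding wderiv_def by (rule someI[where P = "has_weak_deriv T k u"])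

lemma wderiv_AE_eq: "has_weak_deriv T k u v \<Longrightarrow> AE t in leb T. wderiv T k u t = v t"
  by (rule has_weak_deriv_unique[OF has_weak_deriv_wderiv])

lemma abs_cont_test_function: "\<phi> \<in> test_functions T \<Longrightarrow> 0 \<le> T \<Longrightarrow> abs_cont T \<phi> (deriv \<phi>)"
  by (rule abs_cont_C1) (auto intro: smooth_continuous smooth_deriv smooth_has_deriv test_functions_smooth)

text \<open>Integration by parts; the boundary terms vanish with the test function at 0 and
  T.\<close>

lemma abs_cont_integral_test:
  assumes T: "0 < T" and g: "abs_cont T g v" and \<phi>: "\<phi> \<in> test_functions T"
  shows "(\<integral>t. g t * deriv \<phi> t \<partial>leb T) = - (\<integral>t. v t * \<phi> t \<partial>leb T)"
proof -
  have abs_cont: "abs_cont T (\<lambda>t. g t * \<phi> t) (\<lambda>t. v t * \<phi> t + deriv \<phi> t * g t)"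
    using T by (intro abs_cont_mult g abs_cont_test_function \<phi>) simp
  have "(\<integral>t. v t * \<phi> t + deriv \<phi> t * g t \<partial>leb T) = 0"
    using abs_cont_integral[OF abs_cont] T test_functions_eq_0[OF \<phi>] by simp
  moreover have "integrable (leb T) (\<lambda>t. v t * \<phi> t)"
    by (rule integrable_leb_mult_continuous(2)[OF test_functions_continuous[OF \<phi>] abs_cont_integrable[OF g]])
  moreover have "integrable (leb T) (\<lambda>t. deriv \<phi> t * g t)"
    by (rule integrable_leb_mult_continuous(2)[OF abs_cont_continuous[OF g]
          integrable_leb_continuous[OF test_functions_continuous[OF test_functions_deriv[OF \<phi>]]]])
  ultimately show ?thesis by (simp add: mult.commute)
qed

lemma AE_integral_mult_cong:
  fixes u g f :: "real \<Rightarrow> real"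
  assumes "AE t in leb T. u t = g t" "u \<in> borel_measurable (leb T)" "f \<in> borel_measurable (leb T)"
  shows "(\<integral>t. u t * f t \<partial>leb T) = (\<integral>t. g t * f t \<partial>leb T)"
  using assms measurable_leb_AE[OF assms(2,1)] by (intro integral_cong_AE) auto

lemma abs_cont_AE_integrable:
  assumes "abs_cont T g v" "u \<in> borel_measurable (leb T)" "AE t in leb T. u t = g t"
  shows "integrable (leb T) u"
  using integrable_leb_continuous[OF abs_cont_continuous[OF assms(1)]] assms(2,3)
  by (subst integrable_cong_AE[of _ _ g]) (auto dest: borel_measurable_integrable)

lemma test_functions_measurable: "\<phi> \<in> test_functions T \<Longrightarrow> \<phi> \<in> borel_measurable (leb T)"
  by (intro measurable_leb_continuous test_functions_continuous)

lemma abs_cont_has_weak_deriv: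
  assumes T: "0 < T" and g: "abs_cont T g v" and u: "u \<in> borel_measurable (leb T)" "AE t in leb T. u t = g t"
  shows "has_weak_deriv T 1 u v"
  unfolding has_weak_deriv_def
proof (intro conjI ballI)
  show "u \<in> L1_loc T" "v \<in> L1_loc T"
    by (intro L1_loc_integrable abs_cont_AE_integrable[OF g u] abs_cont_integrable[OF g])+
  fix \<phi> assume \<phi>: "\<phi> \<in> test_functions T"
  have "(\<integral>t. u t * deriv \<phi> t \<partial>leb T) = - (\<integral>t. v t * \<phi> t \<partial>leb T)"
    using abs_cont_integral_test[OF T g \<phi>]
      AE_integral_mult_cong[OF u(2,1) test_functions_measurable[OF test_functions_deriv[OF \<phi>]]]
    by (rule trans[rotated])
  then show "(\<integral>t. u t * (deriv ^^ 1) \<phi> t \<partial>leb T) = (- 1) ^ 1 * (\<integral>t. v t * \<phi> t \<partial>leb T)"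
    by simp
qed

lemma abs_cont_has_weak_deriv_2:
  assumes T: "0 < T" and g: "abs_cont T g g1" and g1: "abs_cont T g1 v"
    and u: "u \<in> borel_measurable (leb T)" "AE t in leb T. u t = g t"
  shows "has_weak_deriv T 2 u v"
  unfolding has_weak_deriv_def
proof (intro conjI ballI)
  show "u \<in> L1_loc T" "v \<in> L1_loc T"
    by (intro L1_loc_integrable abs_cont_AE_integrable[OF g u] abs_cont_integrable[OF g1])+
  fix \<phi> assume \<phi>: "\<phi> \<in> test_functions T"
  note \<phi>' = test_functions_deriv[OF \<phi>]
  have "(\<integral>t. u t * deriv (deriv \<phi>) t \<partial>leb T) = (\<integral>t. g t * deriv (deriv \<phi>) t \<partial>leb T)"
    by (rule AE_integral_mult_cong[OF u(2,1) test_functions_measurable[OF test_functions_deriv[OF \<phi>']]])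
  also have "\<dots> = (\<integral>t. v t * \<phi> t \<partial>leb T)"
    using abs_cont_integral_test[OF T g \<phi>'] abs_cont_integral_test[OF T g1 \<phi>] by linarith
  finally show "(\<integral>t. u t * (deriv ^^ 2) \<phi> t \<partial>leb T) = (- 1) ^ 2 * (\<integral>t. v t * \<phi> t \<partial>leb T)"
    by (simp add: numeral_2_eq_2)
qed

section \<open>Weak derivatives and absolutely continuous representatives\<close>

text \<open>An antiderivative is constant on either side of the support of \<open>\<phi>\<close>.
  Normalised to vanish at 0 it vanishes to the left, and the zero mean makes it vanish to the
  right.\<close>

lemma test_functions_antiderivative:
  assumes T: "0 < T" and \<phi>: "\<phi> \<in> test_functions T" and zero: "(\<integral>t. \<phi> t \<partial>leb T) = 0"
  obtains \<Phi> where "\<Phi> \<in> test_functions T" "deriv \<Phi> = \<phi>"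
proof -
  have "\<exists>F. \<forall>x::real. -\<infinity> < ereal x \<longrightarrow> ereal x < \<infinity> \<longrightarrow> (F has_vector_derivative \<phi> x) (at x)"
    by (rule einterval_antiderivative)
      (use test_functions_continuous[OF \<phi>, of UNIV] in \<open>auto simp: continuous_on_eq_continuous_at\<close>)
  then obtain F where F: "\<And>x. (F has_real_derivative \<phi> x) (at x)"
    by (auto simp: has_real_derivative_iff_has_vector_derivative)
  define \<Phi> where "\<Phi> = (\<lambda>x. F x - F 0)"
  have D: "(\<Phi> has_real_derivative \<phi> x) (at x)" for x
    unfolding \<Phi>_def using DERIV_diff[OF F DERIV_const] by simp
  have "abs_cont T \<Phi> \<phi>"
    using T D test_functions_continuous[OF \<phi>] by (intro abs_cont_C1) auto
  from abs_cont_integral[OF this] have ends: "\<Phi> 0 = 0" "\<Phi> T = 0"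
    using T zero by (auto simp: \<Phi>_def)
  obtain a b where ab: "0 < a" "b < T" "\<And>x. x \<notin> {a..b} \<Longrightarrow> \<phi> x = 0"
    using \<phi> by (metis test_functionsE)
  have const: "\<Phi> x = \<Phi> y" if "convex A" "A \<inter> {a..b} = {}" "x \<in> A" "y \<in> A" for A x y
  proof -
    have "(\<Phi> has_real_derivative 0) (at z within A)" if "z \<in> A" for z
    proof -
      have "z \<notin> {a..b}" using that \<open>A \<inter> {a..b} = {}\<close> by blast
      then show ?thesis using has_field_derivative_at_within[OF D[of z]] ab(3) by simp
    qed
    then show ?thesis
      using has_field_derivative_zero_constant[OF \<open>convex A\<close>] that(3,4) by metis
  qed
  have "\<Phi> x = 0" if "x \<notin> {a..b}" for x
  proof (cases "x < a")
    case True
    moreover have "{..<a} \<inter> {a..b} = {}" by auto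
    ultimately show ?thesis using const[of "{..<a}" x 0] ab ends by simp
  next
    case False
    moreover have "{b<..} \<inter> {a..b} = {}" by auto
    ultimately show ?thesis using that const[of "{b<..}" x T] ab ends by simp
  qed
  then have "\<Phi> \<in> test_functions T"
    using ab smooth_of_deriv[OF D test_functions_smooth[OF \<phi>]] by (intro test_functionsI[of _ a b]) auto
  moreover have "deriv \<Phi> = \<phi>" using D by (auto intro: DERIV_imp_deriv)
  ultimately show thesis by (rule that)
qed

lemma test_functions_diff_scale:
  assumes "\<phi> \<in> test_functions T" "\<psi> \<in> test_functions T"
  shows "(\<lambda>x. \<phi> x - c * \<psi> x) \<in> test_functions T"
proof -
  obtain a b where ab: "smooth \<phi>" "0 < a" "b < T" "\<And>x. x \<notin> {a..b} \<Longrightarrow> \<phi> x = 0"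
    using assms(1) by (metis test_functionsE)
  obtain a' b' where ab': "smooth \<psi>" "0 < a'" "b' < T" "\<And>x. x \<notin> {a'..b'} \<Longrightarrow> \<psi> x = 0"
    using assms(2) by (metis test_functionsE)
  have "smooth (\<lambda>x. \<phi> x + (- c) * \<psi> x)"
    by (rule smooth_add[OF ab(1) smooth_mult[OF smooth_const ab'(1)]])
  moreover have "\<phi> x - c * \<psi> x = 0" if "x \<notin> {min a a'..max b b'}" for x
  proof -
    have "x \<notin> {a..b}" "x \<notin> {a'..b'}" using that by auto
    then show ?thesis using ab(4) ab'(4) by simp
  qed
  ultimately show ?thesis
    using ab ab' by (intro test_functionsI[of _ "min a a'" "max b b'"]) auto
qed

lemma measure_leb: "0 \<le> T \<Longrightarrow> measure (leb T) (space (leb T)) = T"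
  by (simp add: measure_restrict_space)

text \<open>If all these integrals vanished, the fundamental lemma applied to the constant 1 would
  give 1 = 0 almost everywhere on an interval of positive length.\<close>

lemma ex_test_function_integral_neq_0:
  assumes T: "0 < T"
  obtains \<rho> where "\<rho> \<in> test_functions T" "(\<integral>t. \<rho> t \<partial>leb T) \<noteq> 0"
proof (rule ccontr)
  assume "\<not> thesis"
  then have *: "(\<integral>t. \<rho> t \<partial>leb T) = 0" if "\<rho> \<in> test_functions T" for \<rho>
    using that \<open>\<And>\<rho>. \<rho> \<in> test_functions T \<Longrightarrow> integral\<^sup>L (leb T) \<rho> \<noteq> 0 \<Longrightarrow> thesis\<close> by blast
  have "AE t in leb T. (1::real) = 0"
    by (rule fundamental_lemma_of_variations)
      (auto simp: * intro!: L1_loc_integrable integrable_leb_continuous)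
  then have "(\<integral>t. (1::real) \<partial>leb T) = 0"
    by (intro integral_eq_zero_AE) simp
  then show False using T measure_leb[of T] by simp
qed

text \<open>The du Bois-Reymond lemma. Every test function is a derivative of a test function plus a
  multiple of one fixed \<open>\<rho>\<close>, so testing \<open>r\<close> is determined by its
  average against \<open>\<rho>\<close>, which is the constant.\<close>

lemma weak_deriv_0_imp_const:
  assumes T: "0 < T" and r: "integrable (leb T) r"
    and zero: "\<And>\<phi>. \<phi> \<in> test_functions T \<Longrightarrow> (\<integral>t. r t * deriv \<phi> t \<partial>leb T) = 0"
  obtains c where "AE t in leb T. r t = c"
proof -
  obtain \<rho> where \<rho>: "\<rho> \<in> test_functions T" and I: "(\<integral>t. \<rho> t \<partial>leb T) \<noteq> 0"
    using ex_test_function_integral_neq_0[OF T] by blast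
  define c where "c = (\<integral>t. r t * \<rho> t \<partial>leb T) / (\<integral>t. \<rho> t \<partial>leb T)"
  have cc: "integrable (leb T) (\<lambda>t. c)" by (rule integrable_leb_continuous) simp
  have int: "integrable (leb T) \<phi>" "integrable (leb T) (\<lambda>t. r t * \<phi> t)" if "\<phi> \<in> test_functions T" for \<phi>
    using that r integrable_leb_mult_continuous(2)[OF test_functions_continuous r]
    by (auto intro: integrable_leb_continuous test_functions_continuous)
  have "AE t in leb T. r t - c = 0"
  proof (rule fundamental_lemma_of_variations)
    show "(\<lambda>t. r t - c) \<in> L1_loc T"
      using r cc by (intro L1_loc_integrable Bochner_Integration.integrable_diff)
    fix \<psi> assume \<psi>: "\<psi> \<in> test_functions T"
    \<comment> \<open>Chosen so that \<open>\<psi>\<close> minus \<open>d\<close> times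
      \<open>\<rho>\<close> has mean zero and hence an antiderivative among the test
      functions.\<close>
    define d where "d = (\<integral>t. \<psi> t \<partial>leb T) / (\<integral>t. \<rho> t \<partial>leb T)"
    define \<phi> where "\<phi> = (\<lambda>x. \<psi> x - d * \<rho> x)"
    have \<phi>: "\<phi> \<in> test_functions T" unfolding \<phi>_def by (rule test_functions_diff_scale[OF \<psi> \<rho>])
    have "(\<integral>t. \<phi> t \<partial>leb T) = 0"
      unfolding \<phi>_def using int[OF \<psi>] int[OF \<rho>] I by (simp add: d_def)
    then obtain \<Phi> where "\<Phi> \<in> test_functions T" "deriv \<Phi> = \<phi>"
      using test_functions_antiderivative[OF T \<phi>] by blast
    then have "(\<integral>t. r t * \<phi> t \<partial>leb T) = 0" using zero by blast
    moreover have "(\<integral>t. r t * \<phi> t \<partial>leb T) = (\<integral>t. r t * \<psi> t - d * (r t * \<rho> t) \<partial>leb T)"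
      by (simp add: \<phi>_def algebra_simps)
    ultimately have "(\<integral>t. r t * \<psi> t \<partial>leb T) = d * (\<integral>t. r t * \<rho> t \<partial>leb T)"
      using int[OF \<psi>] int[OF \<rho>] by simp
    also have "\<dots> = c * (\<integral>t. \<psi> t \<partial>leb T)" by (simp add: c_def d_def)
    finally show "(\<integral>t. (r t - c) * \<psi> t \<partial>leb T) = 0"
      using int[OF \<psi>] by (simp add: left_diff_distrib)
  qed
  then have "AE t in leb T. r t = c" by simp
  then show thesis by (rule that)
qed

text \<open>Subtracting the primitive of \<open>v\<close> from \<open>u\<close> leaves a function
  with weak derivative 0, hence a constant.\<close>

lemma weak_deriv_imp_abs_cont:
  assumes T: "0 < T" and w: "has_weak_deriv T 1 u v"
    and u: "integrable (leb T) u" and v: "integrable (leb T) v"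
  obtains g where "abs_cont T g v" "AE t in leb T. u t = g t"
proof -
  define r where "r = (\<lambda>t. u t - primitive T v t)"
  have p: "integrable (leb T) (primitive T v)"
    by (rule integrable_leb_continuous[OF primitive_continuous[OF v]])
  have r: "integrable (leb T) r"
    unfolding r_def using u p by simp
  have abs_cont: "abs_cont T (primitive T v) v" using abs_cont_primitive[OF v, of 0] by simp
  have "(\<integral>t. r t * deriv \<phi> t \<partial>leb T) = 0" if \<phi>: "\<phi> \<in> test_functions T" for \<phi>
  proof -
    have "(\<integral>t. u t * deriv \<phi> t \<partial>leb T) = - (\<integral>t. v t * \<phi> t \<partial>leb T)"
      using w \<phi> by (simp add: has_weak_deriv_def)
    then show ?thesis
      using abs_cont_integral_test[OF T abs_cont \<phi>]
        integrable_leb_mult_continuous(2)[OF test_functions_continuous[OF test_functions_deriv[OF \<phi>]] u]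
        integrable_leb_mult_continuous(2)[OF test_functions_continuous[OF test_functions_deriv[OF \<phi>]] p]
      by (simp add: r_def left_diff_distrib)
  qed
  then obtain c where c: "AE t in leb T. r t = c"
    using weak_deriv_0_imp_const[OF T r] by blast
  show thesis
  proof (rule that[OF abs_cont_primitive[OF v, of c]])
    show "AE t in leb T. u t = c + primitive T v t"
      using c by eventually_elim (simp add: r_def)
  qed
qed

text \<open>The coincidence set is closed and has full measure in (0,T), so it contains (0,T) and,
  by continuity, both endpoints. The endpoint 0 is where traces are taken.\<close>

lemma continuous_AE_eq_imp_eq:
  fixes g h :: "real \<Rightarrow> real"
  assumes T: "0 < T" and g: "continuous_on {0..T} g" and h: "continuous_on {0..T} h"
    and ae: "AE t in leb T. g t = h t" and t: "t \<in> {0..T}"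
  shows "g t = h t"
proof -
  have cont: "continuous_on {0..T} (\<lambda>t. g t - h t)" by (intro continuous_intros g h)
  then have cl: "closed ((\<lambda>t. g t - h t) -` {0} \<inter> {0..T})"
    by (intro continuous_on_closed_vimage[THEN iffD1, rule_format]) auto
  have ae': "AE t\<in>{0<..<T} in lebesgue. t \<in> (\<lambda>t. g t - h t) -` {0} \<inter> {0..T}"
    using ae by (subst (asm) AE_restrict_space_iff) (auto elim: eventually_mono)
  have "g s - h s = 0" if "s \<in> {0<..<T}" for s
    using mem_closed_if_AE_lebesgue_open[OF _ cl ae' that] by simp
  moreover have "closure {0<..<T} = {0..T}" using T by simp
  ultimately have "g t - h t = 0"
    using continuous_constant_on_closure[of "{0<..<T}" "\<lambda>t. g t - h t" 0 t] cont t by simp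
  then show ?thesis by simp
qed

lemma pt_val_eq:
  assumes T: "0 < T" and g: "continuous_on {0..T} g" and ae: "AE t in leb T. u t = g t" and t: "t \<in> {0..T}"
  shows "pt_val T u t = g t"
  unfolding pt_val_def
proof (rule the_equality)
  show "\<exists>h. continuous_on {0..T} h \<and> (AE t in leb T. u t = h t) \<and> g t = h t"
    by (intro exI[of _ g] conjI g ae refl)
  fix c assume "\<exists>h. continuous_on {0..T} h \<and> (AE t in leb T. u t = h t) \<and> c = h t"
  then obtain h where h: "continuous_on {0..T} h" "AE t in leb T. u t = h t" "c = h t" by blast
  have "AE t in leb T. h t = g t" using h(2) ae by eventually_elim simp
  from continuous_AE_eq_imp_eq[OF T h(1) g this t] show "c = g t" by (simp add: h(3))
qed

section \<open>The space of square integrable functions\<close>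

lemma L2_space_continuous: "continuous_on {0..T} g \<Longrightarrow> g \<in> L2_space T"
  unfolding L2_space_def
  by (auto intro!: measurable_leb_continuous integrable_leb_continuous continuous_on_power)

lemma L2_space_measurable: "f \<in> L2_space T \<Longrightarrow> f \<in> borel_measurable (leb T)"
  and L2_space_square_integrable: "f \<in> L2_space T \<Longrightarrow> integrable (leb T) (\<lambda>t. (f t)\<^sup>2)"
  by (auto simp: L2_space_def)

lemma L2_space_mult_integrable:
  assumes f: "f \<in> L2_space T" and g: "g \<in> L2_space T"
  shows "integrable (leb T) (\<lambda>t. f t * g t)"
proof (rule Bochner_Integration.integrable_bound)
  show "integrable (leb T) (\<lambda>t. (f t)\<^sup>2 + (g t)\<^sup>2)"
    by (intro Bochner_Integration.integrable_add L2_space_square_integrable f g)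
  show "(\<lambda>t. f t * g t) \<in> borel_measurable (leb T)"
    by (intro borel_measurable_times L2_space_measurable f g)
  have "\<bar>x * y\<bar> \<le> x\<^sup>2 + y\<^sup>2" for x y :: real
    using sum_squares_bound[of "\<bar>x\<bar>" "\<bar>y\<bar>"] mult_nonneg_nonneg[of "\<bar>x\<bar>" "\<bar>y\<bar>"]
    unfolding abs_mult power2_abs by linarith
  then show "AE t in leb T. norm (f t * g t) \<le> norm ((f t)\<^sup>2 + (g t)\<^sup>2)"
    by (intro AE_I2) (simp add: abs_of_nonneg)
qed

lemma L2_space_integrable: "f \<in> L2_space T \<Longrightarrow> integrable (leb T) f"
  using L2_space_mult_integrable[of f T "\<lambda>_. 1"] L2_space_continuous[of T "\<lambda>_. 1"] by simp

lemma L2_space_scale: "f \<in> L2_space T \<Longrightarrow> (\<lambda>t. c * f t) \<in> L2_space T"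
  by (auto simp: L2_space_def power_mult_distrib)

lemma L2_space_add:
  assumes f: "f \<in> L2_space T" and g: "g \<in> L2_space T"
  shows "(\<lambda>t. f t + g t) \<in> L2_space T"
proof -
  have "integrable (leb T) (\<lambda>t. (f t)\<^sup>2 + (g t)\<^sup>2 + 2 * (f t * g t))"
    by (intro Bochner_Integration.integrable_add integrable_mult_right L2_space_square_integrable
        L2_space_mult_integrable f g)
  moreover have "(\<lambda>t. f t + g t) \<in> borel_measurable (leb T)"
    by (intro borel_measurable_add L2_space_measurable f g)
  ultimately show ?thesis
    by (simp add: L2_space_def power2_sum mult.assoc)
qed

lemma L2_space_diff: "f \<in> L2_space T \<Longrightarrow> g \<in> L2_space T \<Longrightarrow> (\<lambda>t. f t - g t) \<in> L2_space T"
  using L2_space_add[OF _ L2_space_scale[of g T "-1"]] by simp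

lemma L2_space_mult_continuous:
  assumes h: "continuous_on {0..T} h" and f: "f \<in> L2_space T"
  shows "(\<lambda>t. h t * f t) \<in> L2_space T"
  using integrable_leb_mult_continuous(1)[OF continuous_on_power[OF h, of 2] L2_space_square_integrable[OF f]]
    measurable_leb_continuous[OF h] L2_space_measurable[OF f]
  by (simp add: L2_space_def power_mult_distrib)

lemma L2_space_AE:
  assumes f: "f \<in> L2_space T" and eq: "AE t in leb T. f t = g t"
  shows "g \<in> L2_space T"
proof -
  have g: "g \<in> borel_measurable (leb T)"
    by (rule measurable_leb_AE[OF L2_space_measurable[OF f] eq])
  have "integrable (leb T) (\<lambda>t. (g t)\<^sup>2) = integrable (leb T) (\<lambda>t. (f t)\<^sup>2)"
  proof (rule integrable_cong_AE)
    show "AE t in leb T. (g t)\<^sup>2 = (f t)\<^sup>2" using eq by eventually_elim simp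
  qed (use g L2_space_measurable[OF f] in auto)
  then show ?thesis
    using g L2_space_square_integrable[OF f] by (simp add: L2_space_def)
qed

lemma L2_inner_cong:
  assumes f: "f \<in> L2_space T" and g: "g \<in> L2_space T"
    and f': "AE t in leb T. f t = f' t" and g': "AE t in leb T. g t = g' t"
  shows "L2_inner T f g = L2_inner T f' g'"
  unfolding L2_inner_def
proof (rule integral_cong_AE)
  show "AE t in leb T. f t * g t = f' t * g' t"
    using f' g' by eventually_elim simp
qed (intro borel_measurable_times L2_space_measurable L2_space_AE[OF f f'] L2_space_AE[OF g g'] f g)+

lemma L2_nrm_cong: "f \<in> L2_space T \<Longrightarrow> AE t in leb T. f t = f' t \<Longrightarrow> L2_nrm T f = L2_nrm T f'"
  unfolding L2_nrm_def by (simp add: L2_inner_cong[of f T f f' f'])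

lemma L2_inner_self_nonneg: "0 \<le> L2_inner T f f"
  unfolding L2_inner_def by (rule integral_nonneg_AE) simp

lemma L2_nrm_nonneg: "0 \<le> L2_nrm T f"
  unfolding L2_nrm_def by (simp add: L2_inner_self_nonneg)

lemma L2_nrm_square: "(L2_nrm T f)\<^sup>2 = L2_inner T f f"
  unfolding L2_nrm_def by (simp add: L2_inner_self_nonneg)

lemma L2_inner_commute: "L2_inner T f g = L2_inner T g f"
  unfolding L2_inner_def by (simp add: mult.commute)

lemma L2_inner_add_left:
  assumes "f \<in> L2_space T" "g \<in> L2_space T" "h \<in> L2_space T"
  shows "L2_inner T (\<lambda>t. f t + g t) h = L2_inner T f h + L2_inner T g h"
  unfolding L2_inner_def
  using L2_space_mult_integrable[OF assms(1,3)] L2_space_mult_integrable[OF assms(2,3)]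
  by (simp add: distrib_right)

lemma L2_inner_scale_left: "L2_inner T (\<lambda>t. c * f t) h = c * L2_inner T f h"
  unfolding L2_inner_def by (simp add: mult.assoc)

lemma L2_inner_diff_left:
  assumes "f \<in> L2_space T" "g \<in> L2_space T" "h \<in> L2_space T"
  shows "L2_inner T (\<lambda>t. f t - g t) h = L2_inner T f h - L2_inner T g h"
  unfolding L2_inner_def
  using L2_space_mult_integrable[OF assms(1,3)] L2_space_mult_integrable[OF assms(2,3)]
  by (simp add: left_diff_distrib)

lemma L2_nrm_scale: "L2_nrm T (\<lambda>t. c * f t) = \<bar>c\<bar> * L2_nrm T f"
proof -
  have "L2_inner T (\<lambda>t. c * f t) (\<lambda>t. c * f t) = c\<^sup>2 * L2_inner T f f"
    by (simp add: L2_inner_def power2_eq_square mult.left_commute mult.assoc)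
  then show ?thesis by (simp add: L2_nrm_def real_sqrt_mult)
qed

lemma L2_Cauchy_Schwarz:
  assumes f: "f \<in> L2_space T" and g: "g \<in> L2_space T"
  shows "\<bar>L2_inner T f g\<bar> \<le> L2_nrm T f * L2_nrm T g"
proof -
  let ?A = "L2_inner T f f" and ?B = "L2_inner T g g" and ?C = "L2_inner T f g"
  have quad: "0 \<le> x\<^sup>2 * ?A + 2 * x * y * ?C + y\<^sup>2 * ?B" for x y
  proof -
    have fg: "(\<lambda>t. x * f t) \<in> L2_space T" "(\<lambda>t. y * g t) \<in> L2_space T"
      by (intro L2_space_scale f g)+
    note s = L2_space_add[OF fg]
    have "0 \<le> L2_inner T (\<lambda>t. x * f t + y * g t) (\<lambda>t. x * f t + y * g t)"
      by (rule L2_inner_self_nonneg)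
    also have "\<dots> = x * L2_inner T (\<lambda>t. x * f t + y * g t) f + y * L2_inner T (\<lambda>t. x * f t + y * g t) g"
      by (subst L2_inner_add_left[OF fg s])
        (simp add: L2_inner_scale_left L2_inner_commute[of T f] L2_inner_commute[of T g])
    also have "\<dots> = x * (x * ?A + y * ?C) + y * (x * ?C + y * ?B)"
      by (simp add: L2_inner_add_left[OF fg f] L2_inner_add_left[OF fg g] L2_inner_scale_left
          L2_inner_commute[of T g f])
    finally show ?thesis by (simp add: algebra_simps power2_eq_square)
  qed
  have "?C\<^sup>2 \<le> ?A * ?B"
  proof (cases "?B = 0")
    case True
    have "?C = 0"
    proof (rule ccontr)
      assume "?C \<noteq> 0"
      \<comment> \<open>With \<open>?B = 0\<close> the quadratic form at x = 1 is affine in y, and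
        this y gives it the value -1.\<close>
      then have "2 * 1 * (- (?A + 1) / (2 * ?C)) * ?C = - (?A + 1)" by simp
      then show False using quad[of 1 "- (?A + 1) / (2 * ?C)"] True by simp
    qed
    then show ?thesis using True by simp
  next
    case False
    then have B: "0 < ?B" using L2_inner_self_nonneg[of T g] by simp
    \<comment> \<open>The form at x = \<open>?B\<close>, y = \<open>- ?C\<close>, a multiple of its
      minimiser, is exactly this product.\<close>
    have "0 \<le> ?B * (?A * ?B - ?C\<^sup>2)"
      using quad[of ?B "- ?C"] by (simp add: algebra_simps power2_eq_square)
    then show ?thesis using B by (simp add: zero_le_mult_iff)
  qed
  then have "sqrt (?C\<^sup>2) \<le> sqrt (?A * ?B)" by (rule real_sqrt_le_mono)
  then show ?thesis by (simp add: L2_nrm_def real_sqrt_mult)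
qed

lemma L2_nrm_triangle:
  assumes f: "f \<in> L2_space T" and g: "g \<in> L2_space T"
  shows "L2_nrm T (\<lambda>t. f t + g t) \<le> L2_nrm T f + L2_nrm T g"
proof (rule power2_le_imp_le)
  note s = L2_space_add[OF f g]
  have "(L2_nrm T (\<lambda>t. f t + g t))\<^sup>2 = L2_inner T (\<lambda>t. f t + g t) f + L2_inner T (\<lambda>t. f t + g t) g"
    unfolding L2_nrm_square
    by (subst L2_inner_add_left[OF f g s]) (simp add: L2_inner_commute[of T f] L2_inner_commute[of T g])
  also have "\<dots> = (L2_nrm T f)\<^sup>2 + 2 * L2_inner T f g + (L2_nrm T g)\<^sup>2"
    by (simp add: L2_inner_add_left[OF f g f] L2_inner_add_left[OF f g g] L2_nrm_square L2_inner_commute[of T g f])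
  also have "\<dots> \<le> (L2_nrm T f + L2_nrm T g)\<^sup>2"
    using L2_Cauchy_Schwarz[OF f g] by (simp add: power2_sum)
  finally show "(L2_nrm T (\<lambda>t. f t + g t))\<^sup>2 \<le> (L2_nrm T f + L2_nrm T g)\<^sup>2" .
qed (simp add: L2_nrm_nonneg)

lemma L2_nrm_diff_triangle:
  assumes f: "f \<in> L2_space T" and g: "g \<in> L2_space T"
  shows "L2_nrm T (\<lambda>t. f t - g t) \<le> L2_nrm T f + L2_nrm T g"
  using L2_nrm_triangle[OF f L2_space_scale[OF g, of "-1"]] L2_nrm_scale[of T "-1" g] by simp

lemma L2_nrm_mono:
  assumes "f \<in> L2_space T" "g \<in> L2_space T" "AE t in leb T. \<bar>f t\<bar> \<le> \<bar>g t\<bar>"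
  shows "L2_nrm T f \<le> L2_nrm T g"
proof -
  have "L2_inner T f f \<le> L2_inner T g g"
    unfolding L2_inner_def
  proof (rule integral_mono_AE)
    show "AE t in leb T. f t * f t \<le> g t * g t"
      using assms(3) by eventually_elim (metis abs_le_square_iff power2_eq_square)
  qed (use assms in \<open>auto intro: L2_space_mult_integrable\<close>)
  then show ?thesis by (simp add: L2_nrm_def)
qed

lemma L2_nrm_const: "0 \<le> T \<Longrightarrow> L2_nrm T (\<lambda>_. c) = \<bar>c\<bar> * sqrt T"
  using L2_nrm_scale[of T c "\<lambda>_. 1"] measure_leb[of T] by (simp add: L2_nrm_def L2_inner_def)

text \<open>For \<open>g 0 = 0\<close> this is the Poincare inequality, for general \<open>g\<close> a trace estimate.\<close>
lemma abs_cont_variation_L2: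
  assumes T: "0 \<le> T" and g: "abs_cont T g v" and v: "v \<in> L2_space T"
  shows "L2_nrm T (\<lambda>t. g t - g 0) \<le> T * L2_nrm T v"
proof -
  have one: "(\<lambda>_. 1) \<in> L2_space T" by (rule L2_space_continuous) simp
  have cont: "continuous_on {0..T} (\<lambda>t. g t - g 0)"
    by (intro continuous_on_diff continuous_on_const abs_cont_continuous[OF g])
  \<comment> \<open>One factor sqrt T comes from Cauchy-Schwarz against the constant 1; taking the
    norm of the resulting constant bound supplies the other.\<close>
  have bound: "\<bar>g t - g 0\<bar> \<le> sqrt T * L2_nrm T v" if "t \<in> {0<..<T}" for t
  proof -
    have abs: "(\<lambda>s. \<bar>v s\<bar>) \<in> L2_space T"
      using v by (auto simp: L2_space_def)
    have "\<bar>primitive T v t\<bar> \<le> (\<integral>s. \<bar>indicator {..t} s * v s\<bar> \<partial>leb T)"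
      unfolding primitive_def using integral_norm_bound[of "leb T" "\<lambda>s. indicator {..t} s * v s"] by simp
    also have "\<dots> \<le> (\<integral>s. 1 * \<bar>v s\<bar> \<partial>leb T)"
    proof (rule integral_mono_AE)
      show "AE s in leb T. \<bar>indicator {..t} s * v s\<bar> \<le> 1 * \<bar>v s\<bar>"
        by (auto simp: indicator_def)
    qed (use L2_space_integrable[OF v] integrable_leb_indicator[OF L2_space_integrable[OF v]]
        in \<open>simp_all only: integrable_abs mult_1\<close>)
    also have "\<dots> \<le> L2_nrm T (\<lambda>_. 1) * L2_nrm T (\<lambda>s. \<bar>v s\<bar>)"
      using L2_Cauchy_Schwarz[OF one abs] by (simp add: L2_inner_def)
    also have "\<dots> = sqrt T * L2_nrm T v"
      using L2_nrm_const[OF T, of 1] by (simp add: L2_nrm_def L2_inner_def)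
    finally show ?thesis using abs_cont_eq[OF g, of t] that by simp
  qed
  have "L2_nrm T (\<lambda>t. g t - g 0) \<le> L2_nrm T (\<lambda>_. sqrt T * L2_nrm T v)"
  proof (rule L2_nrm_mono)
    show "AE t in leb T. \<bar>g t - g 0\<bar> \<le> \<bar>sqrt T * L2_nrm T v\<bar>"
      using bound by (intro AE_I2) (use T in \<open>auto simp: L2_nrm_nonneg\<close>)
  qed (intro L2_space_continuous cont continuous_on_const)+
  also have "\<dots> = T * L2_nrm T v"
    using T L2_nrm_const[OF T, of "sqrt T * L2_nrm T v"] by (simp add: abs_mult L2_nrm_nonneg)
  finally show ?thesis .
qed

text \<open>The constant \<open>g 0\<close> is \<open>g\<close> minus its variation from 0, and its
  L2 norm is sqrt T times its absolute value.\<close>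

lemma abs_cont_trace_bound:
  assumes T: "0 \<le> T" and g: "abs_cont T g v" and v: "v \<in> L2_space T"
  shows "sqrt T * \<bar>g 0\<bar> \<le> L2_nrm T g + T * L2_nrm T v"
proof -
  have c: "continuous_on {0..T} g" by (rule abs_cont_continuous[OF g])
  have "L2_nrm T (\<lambda>t. g t - (g t - g 0)) \<le> L2_nrm T g + L2_nrm T (\<lambda>t. g t - g 0)"
    by (intro L2_nrm_diff_triangle L2_space_continuous c continuous_on_diff continuous_on_const)
  then show ?thesis
    using abs_cont_variation_L2[OF assms] L2_nrm_const[OF T, of "g 0"] by (simp add: mult.commute)
qed

section \<open>Representatives of functions with two weak derivatives\<close>

lemma abs_cont_cong_AE:
  assumes g: "abs_cont T g v" and eq: "AE t in leb T. v t = w t"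
  shows "abs_cont T g w"
proof -
  note v = abs_cont_integrable[OF g]
  have w: "w \<in> borel_measurable (leb T)"
    by (rule measurable_leb_AE[OF borel_measurable_integrable[OF v] eq])
  have "integrable (leb T) w"
    using v w eq by (subst integrable_cong_AE[of _ _ v]) (auto elim: eventually_mono)
  moreover have "primitive T v t = primitive T w t" for t
    unfolding primitive_def
  proof (rule integral_cong_AE)
    show "AE s in leb T. indicator {..t} s * v s = indicator {..t} s * w s"
      using eq by eventually_elim simp
  qed (intro borel_measurable_integrable integrable_leb_indicator v \<open>integrable (leb T) w\<close>)+
  ultimately show ?thesis using g unfolding abs_cont_def by metis
qed

lemma exp_weight_abs_cont:
  assumes T: "0 < T"
  shows "abs_cont T (\<lambda>t. exp (- t / T)) (\<lambda>t. - (1 / T) * exp (- t / T))"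
proof (rule abs_cont_C1)
  show "((\<lambda>t. exp (- t / T)) has_real_derivative - (1 / T) * exp (- t / T)) (at t)" for t
    using T by (auto intro!: derivative_eq_intros)
qed (use T in \<open>auto intro!: continuous_intros\<close>)

text \<open>\<open>g\<close> and \<open>g1\<close> are the continuous representatives of \<open>u\<close> and its weak derivative.\<close>
definition H2_rep ::
    "real \<Rightarrow> (real \<Rightarrow> real) \<Rightarrow> (real \<Rightarrow> real) \<Rightarrow> (real \<Rightarrow> real) \<Rightarrow> (real \<Rightarrow> real) \<Rightarrow> bool"
  where "H2_rep T u g g1 g2 \<longleftrightarrow> u \<in> borel_measurable (leb T) \<and> abs_cont T g g1 \<and> abs_cont T g1 g2 \<and>
    g2 \<in> L2_space T \<and> (AE t in leb T. u t = g t)"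

lemma H_space_wderiv:
  assumes "u \<in> H_space k T" "j \<le> k"
  shows "has_weak_deriv T j u (wderiv T j u)" "wderiv T j u \<in> L2_space T"
proof -
  obtain v where v: "v \<in> L2_space T" "has_weak_deriv T j u v"
    using assms by (auto simp: H_space_def)
  show "has_weak_deriv T j u (wderiv T j u)"
    by (rule has_weak_deriv_wderiv[OF v(2)])
  show "wderiv T j u \<in> L2_space T"
    by (rule L2_space_AE[OF v(1) has_weak_deriv_unique[OF v(2) has_weak_deriv_wderiv[OF v(2)]]])
qed

text \<open>The link between the separately given weak derivatives comes from testing the
  first-order identity with the derivative of a test function: it makes the second weak derivative
  of \<open>u\<close> a first weak derivative of \<open>wderiv T 1 u\<close>.\<close>

lemma H2_rep_exists:
  assumes T: "0 < T" and u: "u \<in> H_space 2 T"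
  obtains g g1 where "H2_rep T u g g1 (wderiv T 2 u)"
proof -
  have uL: "u \<in> L2_space T" using u by (simp add: H_space_def)
  have 1: "has_weak_deriv T 1 u (wderiv T 1 u)" "wderiv T 1 u \<in> L2_space T"
    and 2: "has_weak_deriv T 2 u (wderiv T 2 u)" "wderiv T 2 u \<in> L2_space T"
    using H_space_wderiv[OF u] by auto
  have "has_weak_deriv T 1 (wderiv T 1 u) (wderiv T 2 u)"
    unfolding has_weak_deriv_def
  proof (intro conjI ballI)
    show "wderiv T 1 u \<in> L1_loc T" "wderiv T 2 u \<in> L1_loc T"
      using 1 2 by (auto simp: has_weak_deriv_def)
    fix \<phi> assume \<phi>: "\<phi> \<in> test_functions T"
    have "(\<integral>t. u t * (deriv ^^ 2) \<phi> t \<partial>leb T) = (\<integral>t. wderiv T 2 u t * \<phi> t \<partial>leb T)"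
      using 2(1) \<phi> by (simp add: has_weak_deriv_def)
    moreover have "(\<integral>t. u t * (deriv ^^ 1) (deriv \<phi>) t \<partial>leb T)
        = (-1) ^ 1 * (\<integral>t. wderiv T 1 u t * deriv \<phi> t \<partial>leb T)"
      using 1(1) test_functions_deriv[OF \<phi>] unfolding has_weak_deriv_def by blast
    ultimately show "(\<integral>t. wderiv T 1 u t * (deriv ^^ 1) \<phi> t \<partial>leb T)
        = (-1) ^ 1 * (\<integral>t. wderiv T 2 u t * \<phi> t \<partial>leb T)"
      by (simp add: numeral_2_eq_2)
  qed
  then obtain g1 where g1: "abs_cont T g1 (wderiv T 2 u)" "AE t in leb T. wderiv T 1 u t = g1 t"
    using weak_deriv_imp_abs_cont[OF T _ L2_space_integrable[OF 1(2)] L2_space_integrable[OF 2(2)]] by blast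
  obtain g where g: "abs_cont T g (wderiv T 1 u)" "AE t in leb T. u t = g t"
    using weak_deriv_imp_abs_cont[OF T 1(1) L2_space_integrable[OF uL] L2_space_integrable[OF 1(2)]] by blast
  have "H2_rep T u g g1 (wderiv T 2 u)"
    unfolding H2_rep_def
    \<comment> \<open>The derivative attached to \<open>g\<close> is exchanged for its continuous
      representative \<open>g1\<close>, so that a single function has both a trace and a
      derivative.\<close>
    using abs_cont_cong_AE[OF g(1) g1(2)] g1(1) g(2) 2(2) L2_space_measurable[OF uL] by blast
  then show thesis by (rule that)
qed

context
  fixes T :: real and u g g1 g2 :: "real \<Rightarrow> real"
  assumes T: "0 < T" and rep: "H2_rep T u g g1 g2"
begin

lemma H2_rep_abs_cont: "abs_cont T g g1" "abs_cont T g1 g2"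
  and H2_rep_L2: "g2 \<in> L2_space T"
  and H2_rep_AE: "AE t in leb T. u t = g t"
  and H2_rep_measurable: "u \<in> borel_measurable (leb T)"
  using rep by (auto simp: H2_rep_def)

lemma H2_rep_continuous: "continuous_on {0..T} g" "continuous_on {0..T} g1"
  using H2_rep_abs_cont by (auto intro: abs_cont_continuous)

lemma H2_rep_L2_lower: "g \<in> L2_space T" "g1 \<in> L2_space T"
  using H2_rep_continuous by (auto intro: L2_space_continuous)

lemma H2_rep_fun_L2: "u \<in> L2_space T"
proof (rule L2_space_AE[OF H2_rep_L2_lower(1)])
  show "AE t in leb T. g t = u t" using H2_rep_AE by eventually_elim simp
qed

lemma H2_rep_weak_derivs:
  "has_weak_deriv T 0 u u" "has_weak_deriv T 1 u g1" "has_weak_deriv T 2 u g2"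
proof -
  show "has_weak_deriv T 0 u u"
    using L1_loc_integrable[OF L2_space_integrable[OF H2_rep_fun_L2]] by (simp add: has_weak_deriv_def)
  show "has_weak_deriv T 1 u g1"
    by (rule abs_cont_has_weak_deriv[OF T H2_rep_abs_cont(1) H2_rep_measurable H2_rep_AE])
  show "has_weak_deriv T 2 u g2"
    by (rule abs_cont_has_weak_deriv_2[OF T H2_rep_abs_cont H2_rep_measurable H2_rep_AE])
qed

lemma H2_rep_wderiv_AE:
  "AE t in leb T. wderiv T 0 u t = g t"
  "AE t in leb T. wderiv T 1 u t = g1 t"
  "AE t in leb T. wderiv T 2 u t = g2 t"
proof -
  show "AE t in leb T. wderiv T 0 u t = g t"
    using wderiv_AE_eq[OF H2_rep_weak_derivs(1)] H2_rep_AE by eventually_elim simp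
qed (rule wderiv_AE_eq[OF H2_rep_weak_derivs(2)] wderiv_AE_eq[OF H2_rep_weak_derivs(3)])+

lemma H2_rep_pt_val: "pt_val T u 0 = g 0" "pt_val T (wderiv T 1 u) 0 = g1 0"
  by (rule pt_val_eq[OF T H2_rep_continuous(1) H2_rep_AE], use T in simp)
    (rule pt_val_eq[OF T H2_rep_continuous(2) H2_rep_wderiv_AE(2)], use T in simp)

lemma H2_rep_H20: "u \<in> H20 T \<longleftrightarrow> g 0 = 0"
proof -
  have "\<exists>v\<in>L2_space T. has_weak_deriv T j u v" if "j \<le> 2" for j
  proof -
    have "j = 0 \<or> j = 1 \<or> j = 2" using that by linarith
    then show ?thesis
      using H2_rep_weak_derivs H2_rep_fun_L2 H2_rep_L2 H2_rep_L2_lower(2) by blast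
  qed
  then have "u \<in> H_space 2 T" using H2_rep_fun_L2 by (simp add: H_space_def)
  then show ?thesis by (simp add: H20_def H2_rep_pt_val)
qed

lemma H2_rep_a_form:
  assumes w: "H2_rep T w k k1 k2"
  shows "a_form T \<mu> u w = L2_inner T g2 k1 + g1 0 * k1 0 + \<mu> * L2_inner T g k1"
proof -
  have sym: "AE t in leb T. a t = b t" if "AE t in leb T. b t = a t" for a b :: "real \<Rightarrow> real"
    using that by eventually_elim simp
  have kL: "k1 \<in> L2_space T"
    using w by (auto simp: H2_rep_def intro: L2_space_continuous abs_cont_continuous)
  have kw: "AE t in leb T. wderiv T 1 w t = k1 t"
    using w unfolding H2_rep_def by (blast intro: wderiv_AE_eq[OF abs_cont_has_weak_deriv[OF T]])
  have k0: "pt_val T (wderiv T 1 w) 0 = k1 0"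
    using w T by (intro pt_val_eq[OF T _ kw]) (auto simp: H2_rep_def intro: abs_cont_continuous)
  have "L2_inner T (wderiv T 2 u) (wderiv T 1 w) = L2_inner T g2 k1"
    by (rule L2_inner_cong[OF H2_rep_L2 kL sym[OF H2_rep_wderiv_AE(3)] sym[OF kw], symmetric])
  moreover have "L2_inner T u (wderiv T 1 w) = L2_inner T g k1"
    by (rule L2_inner_cong[OF H2_rep_L2_lower(1) kL sym[OF H2_rep_AE] sym[OF kw], symmetric])
  ultimately show ?thesis by (simp only: a_form_def H2_rep_pt_val k0)
qed

lemma H2_rep_diff:
  assumes w: "H2_rep T w k k1 k2"
  shows "H2_rep T (\<lambda>t. u t - w t) (\<lambda>t. g t - k t) (\<lambda>t. g1 t - k1 t) (\<lambda>t. g2 t - k2 t)"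
proof -
  have "AE t in leb T. w t = k t" using w by (simp add: H2_rep_def)
  with H2_rep_AE have "AE t in leb T. u t - w t = g t - k t" by eventually_elim simp
  then show ?thesis
    using rep w unfolding H2_rep_def by (blast intro: abs_cont_diff L2_space_diff borel_measurable_diff)
qed

text \<open>The first derivative of L_T u is the weighted derivative of u by construction; the
  product rule then gives the second.\<close>

lemma H2_rep_LT:
  "H2_rep T (LT T u) (primitive T (\<lambda>t. exp (- t / T) * g1 t)) (\<lambda>t. exp (- t / T) * g1 t)
    (\<lambda>t. - (1 / T) * exp (- t / T) * g1 t + g2 t * exp (- t / T))"
proof -
  let ?k1 = "\<lambda>t. exp (- t / T) * g1 t"
  have ac1: "abs_cont T ?k1 (\<lambda>t. - (1 / T) * exp (- t / T) * g1 t + g2 t * exp (- t / T))"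
    by (rule abs_cont_mult[OF exp_weight_abs_cont[OF T] H2_rep_abs_cont(2)])
  have int: "integrable (leb T) ?k1"
    by (rule integrable_leb_continuous[OF abs_cont_continuous[OF ac1]])
  then have ac0: "abs_cont T (primitive T ?k1) ?k1"
    using abs_cont_primitive[OF int, of 0] by simp
  have "continuous_on {0..T} (\<lambda>t. - (1 / T) * exp (- t / T))" "continuous_on {0..T} (\<lambda>t. exp (- t / T))"
    using T by (auto intro!: continuous_intros)
  then have L2: "(\<lambda>t. - (1 / T) * exp (- t / T) * g1 t + g2 t * exp (- t / T)) \<in> L2_space T"
    using L2_space_mult_continuous[OF _ H2_rep_L2, of "\<lambda>t. exp (- t / T)"]
    by (intro L2_space_add L2_space_mult_continuous[OF _ H2_rep_L2_lower(2)])
      (simp_all only: mult.commute)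
  have eq: "LT T u t = primitive T ?k1 t" if t: "t \<in> {0<..<T}" for t
  proof -
    have *: "AE s in lebesgue. s \<noteq> x" for x :: real
      by (rule AE_completion[OF AE_lborel_singleton])
    let ?P = "\<lambda>s. indicator {0<..<T} s *\<^sub>R (indicator {..t} s * ?k1 s)"
    let ?L = "\<lambda>s. indicator {0..t} s *\<^sub>R (exp (- s / T) * wderiv T 1 u s)"
    \<comment> \<open>\<open>LT\<close> integrates the chosen \<open>wderiv\<close> over the closed
      interval [0,t]. The choice agrees with \<open>g1\<close> only almost everywhere inside (0,T),
      so the endpoint 0 is discarded as a null set.\<close>
    have ae: "AE s in lebesgue. ?P s = ?L s"
    proof -
      have "AE s in lebesgue. s \<in> {0<..<T} \<longrightarrow> wderiv T 1 u s = g1 s"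
        using H2_rep_wderiv_AE(2) by (subst (asm) AE_restrict_space_iff) auto
      then show ?thesis
        using *[of 0] by eventually_elim (use t in \<open>auto simp: indicator_def\<close>)
    qed
    have meas: "?P \<in> borel_measurable lebesgue"
      using integrable_leb_indicator[OF int, of t]
      unfolding integrable_leb_iff set_integrable_def by (rule borel_measurable_integrable)
    have "LT T u t = (\<integral>s. ?P s \<partial>lebesgue)"
      unfolding LT_def set_lebesgue_integral_def
      by (rule integral_cong_AE[symmetric, OF meas borel_measurable_AE[OF meas ae] ae])
    also have "\<dots> = primitive T ?k1 t"
      unfolding primitive_def by (subst integral_restrict_space) auto
    finally show ?thesis .
  qed
  then have ae: "AE t in leb T. primitive T ?k1 t = LT T u t" by (intro AE_I2) simp
  have "LT T u \<in> borel_measurable (leb T)"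
    by (rule measurable_leb_AE[OF measurable_leb_continuous[OF abs_cont_continuous[OF ac0]] ae])
  moreover have "AE t in leb T. LT T u t = primitive T ?k1 t"
    using ae by eventually_elim simp
  ultimately show ?thesis
    unfolding H2_rep_def using ac0 ac1 L2 by blast
qed

end

text \<open>This admits L_T e as a test function in the continuous problem, as Galerkin
  orthogonality requires.\<close>

lemma LT_in_H20: "0 < T \<Longrightarrow> H2_rep T u g g1 g2 \<Longrightarrow> LT T u \<in> H20 T"
  by (subst H2_rep_H20[OF _ H2_rep_LT]) (auto simp: primitive_0)

section \<open>Stability and error bounds\<close>

lemma exp_weight_bounds:
  fixes T t :: real
  assumes T: "0 < T" and t: "t \<in> {0..T}"
  shows "exp (- 1) \<le> exp (- t / T)" "exp (- t / T) \<le> 1"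
proof -
  have "t / T \<le> 1" "0 \<le> t / T"
    using assms by auto
  then have "- 1 \<le> - t / T" "- t / T \<le> 0"
    by simp_all
  then show "exp (- 1) \<le> exp (- t / T)" "exp (- t / T) \<le> 1"
    by (simp_all only: exp_le_cancel_iff exp_le_one_iff)
qed

lemma exp_weight_continuous: "0 < T \<Longrightarrow> continuous_on A (\<lambda>t. exp (- t / T))" for T :: real
  by (intro continuous_intros) auto

lemma exp_weight_L2_nrm_le:
  assumes T: "0 < T" and g: "g \<in> L2_space T"
  shows "L2_nrm T (\<lambda>t. exp (- t / T) * g t) \<le> L2_nrm T g"
proof (rule L2_nrm_mono)
  show "AE t in leb T. \<bar>exp (- t / T) * g t\<bar> \<le> \<bar>g t\<bar>"
    using exp_weight_bounds(2)[OF T] by (intro AE_I2) (auto simp: abs_mult mult_left_le_one_le)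
qed (intro L2_space_mult_continuous exp_weight_continuous T g)+

text \<open>It serves twice: with \<open>g\<close> the derivative of the error, where the term at 0
  is shared with the trace term of the form, and with \<open>g\<close> the error itself, where that
  term vanishes.\<close>

lemma weighted_energy:
  assumes T: "0 < T" and g: "abs_cont T g v" and v: "v \<in> L2_space T"
  shows "L2_inner T v (\<lambda>t. exp (- t / T) * g t) + (g 0)\<^sup>2 / 2
    \<ge> (L2_nrm T g)\<^sup>2 / (2 * exp 1 * T)"
proof -
  let ?E = "\<lambda>t. exp (- t / T)"
  have cont: "continuous_on {0..T} g" by (rule abs_cont_continuous[OF g])
  have gL: "g \<in> L2_space T" by (rule L2_space_continuous[OF cont])
  have Eg: "(\<lambda>t. ?E t * g t) \<in> L2_space T"
    by (rule L2_space_mult_continuous[OF exp_weight_continuous[OF T] gL])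
  note i1 = L2_space_mult_integrable[OF v Eg] and i2 = L2_space_mult_integrable[OF gL Eg]
  have "abs_cont T (\<lambda>t. (g t * g t) * ?E t) (\<lambda>t. (v t * g t + v t * g t) * ?E t + - (1 / T) * ?E t * (g t * g t))"
    by (intro abs_cont_mult g exp_weight_abs_cont T)
  from abs_cont_integral[OF this] T
  have "(\<integral>t. (v t * g t + v t * g t) * ?E t + - (1 / T) * ?E t * (g t * g t) \<partial>leb T)
      = (g T)\<^sup>2 * exp (- 1) - (g 0)\<^sup>2"
    by (simp add: power2_eq_square)
  moreover have "(\<integral>t. (v t * g t + v t * g t) * ?E t + - (1 / T) * ?E t * (g t * g t) \<partial>leb T)
      = (\<integral>t. 2 * (v t * (?E t * g t)) - (1 / T) * (g t * (?E t * g t)) \<partial>leb T)"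
    by (rule Bochner_Integration.integral_cong) (auto simp: algebra_simps)
  moreover have "\<dots> = 2 * L2_inner T v (\<lambda>t. ?E t * g t) - (1 / T) * L2_inner T g (\<lambda>t. ?E t * g t)"
    unfolding L2_inner_def using i1 i2
    by (subst Bochner_Integration.integral_diff) auto
  ultimately have eq: "2 * L2_inner T v (\<lambda>t. ?E t * g t)
      = (1 / T) * L2_inner T g (\<lambda>t. ?E t * g t) + (g T)\<^sup>2 * exp (- 1) - (g 0)\<^sup>2"
    by linarith
  have "exp (- 1) * (L2_nrm T g)\<^sup>2 = (\<integral>t. exp (- 1) * (g t * g t) \<partial>leb T)"
    by (simp add: L2_nrm_square L2_inner_def)
  also have "\<dots> \<le> (\<integral>t. g t * (?E t * g t) \<partial>leb T)"
  proof (rule integral_mono_AE)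
    have "exp (- 1) * (x * x) \<le> x * (?E t * x)" if "t \<in> {0<..<T}" for t x
      using mult_right_mono[OF exp_weight_bounds(1)[OF T, of t], of "x * x"] that
      by (simp add: mult.left_commute)
    then show "AE t in leb T. exp (- 1) * (g t * g t) \<le> g t * (?E t * g t)"
      by (intro AE_I2) simp
  qed (use i2 L2_space_mult_integrable[OF gL gL] in auto)
  finally have "exp (- 1) * (L2_nrm T g)\<^sup>2 \<le> L2_inner T g (\<lambda>t. ?E t * g t)"
    by (simp add: L2_inner_def)
  then have "(1 / T) * (exp (- 1) * (L2_nrm T g)\<^sup>2) \<le> (1 / T) * L2_inner T g (\<lambda>t. ?E t * g t)"
    using T by (intro mult_left_mono) auto
  moreover have "0 \<le> (g T)\<^sup>2 * exp (- 1)" by simp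
  \<comment> \<open>The endpoint term at T has a favourable sign and is dropped; the weight is at
    least 1/e on (0,T), which yields the constant 2 e T.\<close>
  ultimately have le: "(1 / T) * (exp (- 1) * (L2_nrm T g)\<^sup>2) \<le> 2 * L2_inner T v (\<lambda>t. ?E t * g t) + (g 0)\<^sup>2"
    unfolding eq by linarith
  have half: "y / 2 \<le> z + c / 2" if "y \<le> 2 * z + c" for y z c :: real
    using that by simp
  have "(L2_nrm T g)\<^sup>2 / (2 * exp 1 * T) = (1 / T) * (exp (- 1) * (L2_nrm T g)\<^sup>2) / 2"
    by (simp add: exp_minus field_simps)
  also note half[OF le]
  finally show ?thesis .
qed

text \<open>If x exceeded a + b, then x - a and x would both exceed b, and their product would
  exceed b^2.\<close>

lemma quadratic_root_bound:
  fixes x a b :: real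
  assumes "x\<^sup>2 \<le> a * x + b\<^sup>2" "0 \<le> a" "0 \<le> b"
  shows "x \<le> a + b"
proof (rule ccontr)
  assume "\<not> x \<le> a + b"
  then have "0 < x - a" "b < x - a" "b < x" using assms by auto
  then have "b * b < (x - a) * x"
    using assms by (intro mult_strict_mono') auto
  then show False using assms(1) by (simp add: power2_eq_square algebra_simps)
qed

text \<open>Testing with the weighted \<open>e1\<close>: the weight makes the second-order term coercive for
  \<open>e1\<close>, and half of \<open>(e1 0)\<^sup>2\<close> is left over to absorb the trace term on the right.\<close>
lemma weighted_stability:
  assumes T: "0 < T" and \<mu>: "0 \<le> \<mu>" and e: "abs_cont T e e1" and e1: "abs_cont T e1 e2" and e2: "e2 \<in> L2_space T"
    and e0: "e 0 = 0" and F: "F \<in> L2_space T"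
    and eq: "L2_inner T e2 (\<lambda>t. exp (- t / T) * e1 t) + e1 0 * e1 0
        + \<mu> * L2_inner T e (\<lambda>t. exp (- t / T) * e1 t)
      = L2_inner T F (\<lambda>t. exp (- t / T) * e1 t) + \<alpha> * e1 0"
  shows "L2_nrm T e1 \<le> 2 * exp 1 * T * L2_nrm T F + sqrt (exp 1 * T) * \<bar>\<alpha>\<bar>"
proof (rule quadratic_root_bound)
  let ?w = "\<lambda>t. exp (- t / T) * e1 t"
  have e1L: "e1 \<in> L2_space T" by (rule L2_space_continuous[OF abs_cont_continuous[OF e1]])
  have wL: "?w \<in> L2_space T"
    by (rule L2_space_mult_continuous[OF exp_weight_continuous[OF T] e1L])
  \<comment> \<open>Moving the weight from \<open>e1\<close> to \<open>e\<close> turns the mass term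
    into the energy of \<open>e\<close>, which is nonnegative because
    \<open>e 0 = 0\<close>.\<close>
  have swap: "L2_inner T e ?w = L2_inner T e1 (\<lambda>t. exp (- t / T) * e t)"
    unfolding L2_inner_def by (simp add: ac_simps)
  have "0 \<le> (L2_nrm T e)\<^sup>2 / (2 * exp 1 * T)" using T by simp
  also have "\<dots> \<le> L2_inner T e ?w"
    using weighted_energy[OF T e e1L] unfolding swap e0 by simp
  finally have "0 \<le> \<mu> * L2_inner T e ?w" using \<mu> by simp
  moreover have "(L2_nrm T e1)\<^sup>2 / (2 * exp 1 * T) \<le> L2_inner T e2 ?w + (e1 0)\<^sup>2 / 2"
    by (rule weighted_energy[OF T e1 e2])
  moreover have "L2_inner T F ?w \<le> L2_nrm T F * L2_nrm T e1"
    using L2_Cauchy_Schwarz[OF F wL] mult_left_mono[OF exp_weight_L2_nrm_le[OF T e1L] L2_nrm_nonneg[of T F]]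
    by linarith
  \<comment> \<open>Young's inequality with equal halves: the form contributes the full square of
    \<open>e1 0\<close>, one half of which \<open>weighted_energy\<close> uses and the other is
    spent here.\<close>
  moreover have "\<alpha> * e1 0 \<le> \<alpha>\<^sup>2 / 2 + (e1 0)\<^sup>2 / 2"
    using sum_squares_bound[of \<alpha> "e1 0"] by simp
  ultimately have "(L2_nrm T e1)\<^sup>2 / (2 * exp 1 * T) \<le> L2_nrm T F * L2_nrm T e1 + \<alpha>\<^sup>2 / 2"
    using eq by (simp add: power2_eq_square)
  then have "(L2_nrm T e1)\<^sup>2 \<le> (L2_nrm T F * L2_nrm T e1 + \<alpha>\<^sup>2 / 2) * (2 * exp 1 * T)"
    using T by (simp add: pos_divide_le_eq)
  also have "\<dots> = 2 * exp 1 * T * L2_nrm T F * L2_nrm T e1 + (sqrt (exp 1 * T) * \<bar>\<alpha>\<bar>)\<^sup>2"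
    using T by (simp add: power_mult_distrib algebra_simps)
  finally show "(L2_nrm T e1)\<^sup>2 \<le> 2 * exp 1 * T * L2_nrm T F * L2_nrm T e1 + (sqrt (exp 1 * T) * \<bar>\<alpha>\<bar>)\<^sup>2" .
qed (use T in \<open>auto simp: L2_nrm_nonneg\<close>)

section \<open>The natural boundary condition at 0\<close>

lemma L2_inner_exp_tendsto_0:
  assumes f: "f \<in> L2_space T"
  shows "(\<lambda>n. L2_inner T f (\<lambda>t. exp (- real (Suc n) * t))) \<longlonglongrightarrow> 0"
proof -
  have "(\<lambda>n. \<integral>t. f t * exp (- real (Suc n) * t) \<partial>leb T) \<longlonglongrightarrow> (\<integral>t. 0 \<partial>leb T)"
  proof (rule integral_dominated_convergence[where w = "\<lambda>t. \<bar>f t\<bar>"])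
    show "AE t in leb T. (\<lambda>n. f t * exp (- real (Suc n) * t)) \<longlonglongrightarrow> 0"
    proof (rule AE_I2)
      fix t assume "t \<in> space (leb T)"
      then have "exp (- t) < 1" by simp
      then have "(\<lambda>n. exp (- t) ^ Suc n) \<longlonglongrightarrow> 0"
        by (intro LIMSEQ_Suc LIMSEQ_power_zero) simp
      then have "(\<lambda>n. f t * exp (- t) ^ Suc n) \<longlonglongrightarrow> f t * 0"
        by (rule tendsto_mult_left)
      moreover have "exp (- t) ^ Suc n = exp (- real (Suc n) * t)" for n
        using exp_of_nat_mult[of "Suc n" "- t"] by (simp only: mult_minus_left mult_minus_right)
      ultimately show "(\<lambda>n. f t * exp (- real (Suc n) * t)) \<longlonglongrightarrow> 0" by simp
    qed
    show "AE t in leb T. norm (f t * exp (- real (Suc n) * t)) \<le> \<bar>f t\<bar>" for n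
    proof (rule AE_I2)
      fix t assume "t \<in> space (leb T)"
      then have "- real (Suc n) * t \<le> 0" by (intro mult_nonpos_nonneg) auto
      then have "exp (- real (Suc n) * t) \<le> 1" by (simp only: exp_le_one_iff)
      then show "norm (f t * exp (- real (Suc n) * t)) \<le> \<bar>f t\<bar>"
        unfolding real_norm_def abs_mult abs_exp_cancel by (rule mult_left_le) simp
    qed
    show "(\<lambda>t. f t * exp (- real (Suc n) * t)) \<in> borel_measurable (leb T)" for n
      by (intro borel_measurable_times L2_space_measurable[OF f] measurable_leb_continuous continuous_intros)
    show "integrable (leb T) (\<lambda>t. \<bar>f t\<bar>)"
      using L2_space_integrable[OF f] by simp
  qed simp
  then show ?thesis by (simp add: L2_inner_def)
qed

text \<open>The natural boundary condition, from test functions whose derivative concentrates at \<open>0\<close>.\<close>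
lemma continuous_solution_deriv_0:
  assumes T: "0 < T" and f: "f \<in> L2_space T" and sol: "continuous_solution T \<mu> f u"
    and u: "H2_rep T u U U1 U2"
  shows "U1 0 = 0"
proof -
  define k where "k = (\<lambda>n t. exp (- real (Suc n) * t))"
  note UL = H2_rep_L2_lower(1)[OF T u] H2_rep_L2[OF T u]
  have eq: "L2_inner T U2 (k n) + U1 0 + \<mu> * L2_inner T U (k n) = L2_inner T f (k n)" for n
  proof -
    \<comment> \<open>The antiderivative of \<open>k n\<close> that vanishes at 0. Its derivative is
      1 at 0 for every n but tends to 0 elsewhere on (0,T), so in the limit only the trace term
      survives.\<close>
    define w where "w = (\<lambda>t. (1 - k n t) / real (Suc n))"
    have dk: "(k n has_real_derivative - real (Suc n) * k n t) (at t)" for t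
      unfolding k_def by (auto intro!: derivative_eq_intros)
    have ck: "continuous_on A (k n)" for A
      unfolding k_def by (intro continuous_intros)
    have "(w has_real_derivative (0 - - real (Suc n) * k n t) / real (Suc n)) (at t)" for t
      unfolding w_def by (intro DERIV_cdivide DERIV_diff DERIV_const dk)
    then have dw: "(w has_real_derivative k n t) (at t)" for t
      by (simp del: of_nat_Suc)
    have acw: "abs_cont T w (k n)" using T by (intro abs_cont_C1 dw ck) simp
    have ack: "abs_cont T (k n) (\<lambda>t. - real (Suc n) * k n t)"
      using T by (intro abs_cont_C1 dk continuous_intros ck) simp
    have w: "H2_rep T w w (k n) (\<lambda>t. - real (Suc n) * k n t)"
      unfolding H2_rep_def
      by (intro conjI acw ack measurable_leb_continuous[OF abs_cont_continuous[OF acw]]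
          L2_space_continuous continuous_intros ck) simp
    have k0: "k n 0 = 1" by (simp add: k_def)
    have "w \<in> H20 T" using H2_rep_H20[OF T w] by (simp add: w_def k0)
    then have "a_form T \<mu> u w = L2_inner T f (wderiv T 1 w)"
      using sol by (simp add: continuous_solution_def)
    moreover have "L2_inner T f (wderiv T 1 w) = L2_inner T f (k n)"
    proof (rule sym, rule L2_inner_cong)
      show "AE t in leb T. k n t = wderiv T 1 w t"
        using H2_rep_wderiv_AE(2)[OF T w] by eventually_elim simp
    qed (auto intro: f L2_space_continuous ck)
    ultimately show ?thesis using H2_rep_a_form[OF T u w, of \<mu>] by (simp add: k0)
  qed
  have "(\<lambda>n. L2_inner T f (k n) - L2_inner T U2 (k n) - \<mu> * L2_inner T U (k n)) \<longlonglongrightarrow> 0 - 0 - \<mu> * 0"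
    unfolding k_def by (intro tendsto_diff tendsto_mult_left L2_inner_exp_tendsto_0 f UL)
  moreover have "L2_inner T f (k n) - L2_inner T U2 (k n) - \<mu> * L2_inner T U (k n) = U1 0" for n
    using eq[of n] by simp
  ultimately show ?thesis by (simp add: LIMSEQ_const_iff)
qed

section \<open>Galerkin error estimates\<close>

lemma finite_dim_subspace_diff:
  assumes "finite_dim_subspace V" "u \<in> V" "v \<in> V"
  shows "(\<lambda>t. u t - v t) \<in> V"
proof -
  obtain n :: nat and b :: "nat \<Rightarrow> real \<Rightarrow> real"
    where V: "V = {(\<lambda>t. \<Sum>i<n. c i * b i t) | c. True}"
    using assms(1) by (auto simp: finite_dim_subspace_def)
  then obtain c d where "u = (\<lambda>t. \<Sum>i<n. c i * b i t)" "v = (\<lambda>t. \<Sum>i<n. d i * b i t)"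
    using assms(2,3) by auto
  then have "(\<lambda>t. u t - v t) = (\<lambda>t. \<Sum>i<n. (c i - d i) * b i t)"
    by (simp add: sum_subtractf left_diff_distrib)
  then show ?thesis unfolding V by (intro CollectI exI[of _ "\<lambda>i. c i - d i"] conjI TrueI)
qed

lemma finite_dim_subspace_zero:
  assumes "finite_dim_subspace V"
  shows "(\<lambda>_. 0) \<in> V"
proof -
  obtain n :: nat and b :: "nat \<Rightarrow> real \<Rightarrow> real"
    where V: "V = {(\<lambda>t. \<Sum>i<n. c i * b i t) | c. True}"
    using assms by (auto simp: finite_dim_subspace_def)
  then show ?thesis by (auto intro!: exI[of _ "\<lambda>_. 0"])
qed

text \<open>The weighted stability bound is applied to the difference of \<open>u\<^sub>h\<close>
  and \<open>v\<close>. Subtracting \<open>v\<close> in the orthogonality relation turns the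
  right-hand side into the form evaluated at u - v.\<close>

lemma galerkin_error_bound:
  assumes T: "0 < T" and \<mu>: "0 < \<mu>" and V: "finite_dim_subspace V" "V \<subseteq> H20 T"
    and sol: "continuous_solution T \<mu> f u" and dsol: "discrete_solution T \<mu> V f u\<^sub>h"
    and v: "v \<in> V"
    and repu: "H2_rep T u U U1 U2" and reph: "H2_rep T u\<^sub>h H H1 H2" and repv: "H2_rep T v W W1 W2"
  shows "L2_nrm T (\<lambda>t. U1 t - H1 t) \<le> 3 * L2_nrm T (\<lambda>t. U1 t - W1 t)
    + 8 * T * L2_nrm T (\<lambda>t. U2 t - W2 t) + 6 * T * \<mu> * L2_nrm T (\<lambda>t. U t - W t)"
proof -
  define e where "e = (\<lambda>t. u\<^sub>h t - v t)"
  let ?w = "\<lambda>t. exp (- t / T) * (H1 t - W1 t)"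
  have uh: "u\<^sub>h \<in> V" using dsol by (simp add: discrete_solution_def)
  have eV: "e \<in> V" unfolding e_def by (rule finite_dim_subspace_diff[OF V(1) uh v])
  have repe: "H2_rep T e (\<lambda>t. H t - W t) (\<lambda>t. H1 t - W1 t) (\<lambda>t. H2 t - W2 t)"
    unfolding e_def by (rule H2_rep_diff[OF T reph repv])
  have repd: "H2_rep T (\<lambda>t. u t - v t) (\<lambda>t. U t - W t) (\<lambda>t. U1 t - W1 t) (\<lambda>t. U2 t - W2 t)"
    by (rule H2_rep_diff[OF T repu repv])
  note repL = H2_rep_LT[OF T repe]
  have "a_form T \<mu> u (LT T e) = L2_inner T f (wderiv T 1 (LT T e))"
    using sol LT_in_H20[OF T repe] by (simp add: continuous_solution_def)
  moreover have "a_form T \<mu> u\<^sub>h (LT T e) = L2_inner T f (wderiv T 1 (LT T e))"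
    using dsol eV by (simp add: discrete_solution_def)
  ultimately have "L2_inner T H2 ?w + H1 0 * (H1 0 - W1 0) + \<mu> * L2_inner T H ?w
      = L2_inner T U2 ?w + U1 0 * (H1 0 - W1 0) + \<mu> * L2_inner T U ?w"
    using H2_rep_a_form[OF T repu repL, of \<mu>] H2_rep_a_form[OF T reph repL, of \<mu>] by simp
  note orth = this
  note L = H2_rep_L2[OF T repu] H2_rep_L2_lower[OF T repu] H2_rep_L2[OF T reph] H2_rep_L2_lower[OF T reph]
    H2_rep_L2[OF T repv] H2_rep_L2_lower[OF T repv]
  have wL: "?w \<in> L2_space T"
    by (rule L2_space_mult_continuous[OF exp_weight_continuous[OF T] L2_space_diff]) (rule L)+
  \<comment> \<open>With d = u - v, the residual is d'' + \<open>\<mu>\<close> d in the interior,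
    and d'(0) plays the role of \<open>\<alpha>\<close> in
    \<open>weighted_stability\<close>.\<close>
  define F where "F = (\<lambda>t. (U2 t - W2 t) + \<mu> * (U t - W t))"
  note LF = L2_space_diff[OF L(1) L(7)] L2_space_scale[OF L2_space_diff[OF L(2) L(8)], of \<mu>]
  have FL: "F \<in> L2_space T" unfolding F_def by (rule L2_space_add[OF LF])
  have "L2_nrm T (\<lambda>t. H1 t - W1 t)
      \<le> 2 * exp 1 * T * L2_nrm T F + sqrt (exp 1 * T) * \<bar>U1 0 - W1 0\<bar>"
  proof (rule weighted_stability[OF T _ H2_rep_abs_cont[OF T repe] H2_rep_L2[OF T repe] _ FL])
    show "H 0 - W 0 = 0"
      using V uh v H2_rep_H20[OF T reph] H2_rep_H20[OF T repv] by auto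
    show "L2_inner T (\<lambda>t. H2 t - W2 t) ?w + (H1 0 - W1 0) * (H1 0 - W1 0)
        + \<mu> * L2_inner T (\<lambda>t. H t - W t) ?w
      = L2_inner T F ?w + (U1 0 - W1 0) * (H1 0 - W1 0)"
      using orth
      unfolding F_def L2_inner_add_left[OF LF wL] L2_inner_scale_left
        L2_inner_diff_left[OF L(4) L(7) wL] L2_inner_diff_left[OF L(5) L(8) wL]
        L2_inner_diff_left[OF L(1) L(7) wL] L2_inner_diff_left[OF L(2) L(8) wL]
      by (simp add: algebra_simps)
  qed (use \<mu> in simp)
  \<comment> \<open>The constants come from e <= 3, so 2 e <= 6 and sqrt e <= 2. The remaining
    factor sqrt T is just what the trace estimate for u' - v' consumes. The final triangle
    inequality raises 2 to 3, and 6 T + 2 T gives 8 T.\<close>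
  also have "\<dots> \<le> 6 * T * (L2_nrm T (\<lambda>t. U2 t - W2 t) + \<mu> * L2_nrm T (\<lambda>t. U t - W t))
      + 2 * (L2_nrm T (\<lambda>t. U1 t - W1 t) + T * L2_nrm T (\<lambda>t. U2 t - W2 t))"
  proof (rule add_mono)
    have "L2_nrm T F \<le> L2_nrm T (\<lambda>t. U2 t - W2 t) + \<mu> * L2_nrm T (\<lambda>t. U t - W t)"
      unfolding F_def using L2_nrm_triangle[OF LF] \<mu> L2_nrm_scale[of T \<mu> "\<lambda>t. U t - W t"] by simp
    then show "2 * exp 1 * T * L2_nrm T F
        \<le> 6 * T * (L2_nrm T (\<lambda>t. U2 t - W2 t) + \<mu> * L2_nrm T (\<lambda>t. U t - W t))"
      using T exp_le by (intro mult_mono) (auto simp: L2_nrm_nonneg)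
    have "sqrt (exp 1) \<le> 2"
      using exp_le by (intro real_le_lsqrt) auto
    then show "sqrt (exp 1 * T) * \<bar>U1 0 - W1 0\<bar>
        \<le> 2 * (L2_nrm T (\<lambda>t. U1 t - W1 t) + T * L2_nrm T (\<lambda>t. U2 t - W2 t))"
      unfolding real_sqrt_mult mult.assoc
      using T abs_cont_trace_bound[OF _ H2_rep_abs_cont(2)[OF T repd] H2_rep_L2[OF T repd]]
      by (intro mult_mono) auto
  qed
  finally have "L2_nrm T (\<lambda>t. H1 t - W1 t) \<le> \<dots>" .
  moreover have "L2_nrm T (\<lambda>t. (U1 t - W1 t) - (H1 t - W1 t))
      \<le> L2_nrm T (\<lambda>t. U1 t - W1 t) + L2_nrm T (\<lambda>t. H1 t - W1 t)"
    by (intro L2_nrm_diff_triangle L2_space_diff L)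
  ultimately show ?thesis by (simp add: algebra_simps)
qed

text \<open>Translates the norms of the approximation property to representatives. Order 0 is
  included because \<open>wderiv T 0 u\<close> is itself a choice, equal to \<open>u\<close> only
  almost everywhere.\<close>

lemma L2_nrm_wderiv_diff:
  assumes T: "0 < T" and u: "H2_rep T u U U1 U2" and v: "H2_rep T v W W1 W2"
  shows "L2_nrm T (\<lambda>t. wderiv T 0 u t - wderiv T 0 v t) = L2_nrm T (\<lambda>t. U t - W t)"
    and "L2_nrm T (\<lambda>t. wderiv T 1 u t - wderiv T 1 v t) = L2_nrm T (\<lambda>t. U1 t - W1 t)"
    and "L2_nrm T (\<lambda>t. wderiv T 2 u t - wderiv T 2 v t) = L2_nrm T (\<lambda>t. U2 t - W2 t)"
proof -
  have *: "L2_nrm T (\<lambda>t. a t - b t) = L2_nrm T (\<lambda>t. a' t - b' t)"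
    if "a' \<in> L2_space T" "b' \<in> L2_space T" "AE t in leb T. a t = a' t" "AE t in leb T. b t = b' t"
    for a b a' b'
  proof (rule L2_nrm_cong[symmetric, OF L2_space_diff[OF that(1,2)]])
    show "AE t in leb T. a' t - b' t = a t - b t"
      using that(3,4) by eventually_elim simp
  qed
  note LR = H2_rep_L2_lower[OF T u] H2_rep_L2[OF T u] H2_rep_L2_lower[OF T v] H2_rep_L2[OF T v]
  show "L2_nrm T (\<lambda>t. wderiv T 0 u t - wderiv T 0 v t) = L2_nrm T (\<lambda>t. U t - W t)"
    by (rule *[OF LR(1) LR(4) H2_rep_wderiv_AE(1)[OF T u] H2_rep_wderiv_AE(1)[OF T v]])
  show "L2_nrm T (\<lambda>t. wderiv T 1 u t - wderiv T 1 v t) = L2_nrm T (\<lambda>t. U1 t - W1 t)"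
    by (rule *[OF LR(2) LR(5) H2_rep_wderiv_AE(2)[OF T u] H2_rep_wderiv_AE(2)[OF T v]])
  show "L2_nrm T (\<lambda>t. wderiv T 2 u t - wderiv T 2 v t) = L2_nrm T (\<lambda>t. U2 t - W2 t)"
    by (rule *[OF LR(3) LR(6) H2_rep_wderiv_AE(3)[OF T u] H2_rep_wderiv_AE(3)[OF T v]])
qed

lemma L2_nrm_H2_rep:
  assumes T: "0 < T" and u: "H2_rep T u U U1 U2"
  shows "L2_nrm T u = L2_nrm T U" "L2_nrm T (wderiv T 1 u) = L2_nrm T U1"
    "L2_nrm T (wderiv T 2 u) = L2_nrm T U2"
proof -
  have sym: "AE t in leb T. b t = a t" if "AE t in leb T. a t = b t" for a b :: "real \<Rightarrow> real"
    using that by eventually_elim simp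
  show "L2_nrm T u = L2_nrm T U"
    by (rule L2_nrm_cong[symmetric, OF H2_rep_L2_lower(1)[OF T u] sym[OF H2_rep_AE[OF T u]]])
  show "L2_nrm T (wderiv T 1 u) = L2_nrm T U1"
    by (rule L2_nrm_cong[symmetric, OF H2_rep_L2_lower(2)[OF T u] sym[OF H2_rep_wderiv_AE(2)[OF T u]]])
  show "L2_nrm T (wderiv T 2 u) = L2_nrm T U2"
    by (rule L2_nrm_cong[symmetric, OF H2_rep_L2[OF T u] sym[OF H2_rep_wderiv_AE(3)[OF T u]]])
qed

lemma galerkin_stability_bound:
  assumes T: "0 < T" and \<mu>: "0 < \<mu>" and V: "finite_dim_subspace V" "V \<subseteq> H20 T" and f: "f \<in> L2_space T"
    and sol: "continuous_solution T \<mu> f u" and dsol: "discrete_solution T \<mu> V f u\<^sub>h"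
    and repu: "H2_rep T u U U1 U2" and reph: "H2_rep T u\<^sub>h H H1 H2"
  shows "L2_nrm T (\<lambda>t. U1 t - H1 t) \<le> (11 * T + 6 * \<mu> * T ^ 3) * L2_nrm T U2"
proof -
  have zc: "abs_cont T (\<lambda>_. 0) (\<lambda>_. 0)" using T by (intro abs_cont_C1) auto
  have repz: "H2_rep T (\<lambda>_. 0) (\<lambda>_. 0) (\<lambda>_. 0) (\<lambda>_. 0)"
    unfolding H2_rep_def using zc by (auto intro: L2_space_continuous)
  have U1: "L2_nrm T U1 \<le> T * L2_nrm T U2"
    using abs_cont_variation_L2[OF _ H2_rep_abs_cont(2)[OF T repu] H2_rep_L2[OF T repu]] T
      continuous_solution_deriv_0[OF T f sol repu] by simp
  have "U 0 = 0"
    using sol H2_rep_H20[OF T repu] by (simp add: continuous_solution_def)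
  then have "L2_nrm T U \<le> T * L2_nrm T U1"
    using abs_cont_variation_L2[OF _ H2_rep_abs_cont(1)[OF T repu] H2_rep_L2_lower(2)[OF T repu]] T by simp
  also have "\<dots> \<le> T * (T * L2_nrm T U2)"
    using U1 T by (intro mult_left_mono) auto
  finally have "6 * T * \<mu> * L2_nrm T U \<le> 6 * T * \<mu> * (T * (T * L2_nrm T U2))"
    using T \<mu> by (intro mult_left_mono) auto
  moreover have "L2_nrm T (\<lambda>t. U1 t - H1 t) \<le> 3 * L2_nrm T U1 + 8 * T * L2_nrm T U2 + 6 * T * \<mu> * L2_nrm T U"
    using galerkin_error_bound[OF T \<mu> V sol dsol finite_dim_subspace_zero[OF V(1)] repu reph repz] by simp
  \<comment> \<open>The general bound at v = 0 with each lower norm reduced to that of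
    \<open>U2\<close>, at the price of one factor T per order: 3 T + 8 T = 11 T, and 6 T
    \<open>\<mu>\<close> picks up T^2.\<close>
  moreover have "(11 * T + 6 * \<mu> * T ^ 3) * L2_nrm T U2
      = 3 * (T * L2_nrm T U2) + 8 * T * L2_nrm T U2 + 6 * T * \<mu> * (T * (T * L2_nrm T U2))"
    by (simp add: algebra_simps power3_eq_cube)
  ultimately show ?thesis using U1 by linarith
qed

text \<open>Since functions vanishing at \<open>0\<close> satisfy a Poincare inequality, the second inverse
  inequality forces the discrete space to be trivial once \<open>h\<close> exceeds \<open>T * C\<^sub>I\<close>.\<close>
lemma inverse_inequalities_large_h:
  assumes T: "0 < T" and inv: "inverse_inequalities T C\<^sub>I hs S" and h: "h \<in> hs" "0 < h" "T * C\<^sub>I < h"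
    and v: "v \<in> S h" "v \<in> H20 T" and rep: "H2_rep T v W W1 W2"
  shows "L2_nrm T W2 = 0"
proof -
  note N = L2_nrm_H2_rep[OF T rep]
  have 1: "L2_nrm T W1 \<le> C\<^sub>I * inverse h * L2_nrm T W"
    and 2: "L2_nrm T W2 + 1 / T * L2_nrm T W1 \<le> C\<^sub>I * inverse h * L2_nrm T W1"
    using inv h(1) v(1) unfolding inverse_inequalities_def H20_nrm_def N[symmetric] by blast+
  have "W 0 = 0" using v(2) H2_rep_H20[OF T rep] by simp
  then have "L2_nrm T W \<le> T * L2_nrm T W1"
    using abs_cont_variation_L2[OF _ H2_rep_abs_cont(1)[OF T rep] H2_rep_L2_lower(2)[OF T rep]] T by simp
  also have "\<dots> \<le> T * (C\<^sub>I * inverse h * L2_nrm T W)"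
    using 1 T by (intro mult_left_mono) auto
  finally have "L2_nrm T W \<le> (T * C\<^sub>I / h) * L2_nrm T W"
    by (simp add: divide_inverse mult.assoc)
  \<comment> \<open>Chaining the inverse and Poincare inequalities bounds the norm of
    \<open>W\<close> by itself times a factor below 1, so it vanishes. The inverse inequalities then
    pass this on to \<open>W1\<close> and \<open>W2\<close>.\<close>
  then have "(1 - T * C\<^sub>I / h) * L2_nrm T W \<le> 0" by (simp add: left_diff_distrib)
  moreover have "0 < 1 - T * C\<^sub>I / h" using h by simp
  ultimately have "L2_nrm T W = 0"
    using L2_nrm_nonneg[of T W] by (simp add: mult_le_0_iff)
  then have W1: "L2_nrm T W1 = 0" using 1 L2_nrm_nonneg[of T W1] by simp
  then show ?thesis using 2 L2_nrm_nonneg[of T W2] by simp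
qed

theorem theorem3p4:
  fixes T \<mu> C\<^sub>I C\<^sub>a :: real and p :: nat
  assumes "T > 0" and "\<mu> > 0" and "C\<^sub>I > 0" and "C\<^sub>a > 0"
  shows "\<exists>C\<^sub>\<mu> > 0. \<forall>hs S. discrete_family T hs S \<longrightarrow> assumption_A T p C\<^sub>I C\<^sub>a hs S \<longrightarrow>
    (\<forall>h\<in>hs. \<forall>f\<in>L2_space T. \<forall>u u\<^sub>h. \<forall>s::nat.
       continuous_solution T \<mu> f u \<longrightarrow>
       discrete_solution T \<mu> (S h) f u\<^sub>h \<longrightarrow>
       1 \<le> s \<longrightarrow> s \<le> p \<longrightarrow> u \<in> H20 T \<inter> H_space (s + 1) T \<longrightarrow>
       L2_nrm T (\<lambda>t. wderiv T 1 u t - wderiv T 1 u\<^sub>h t)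
         \<le> C\<^sub>\<mu> * h ^ (s - 1) * L2_nrm T (wderiv T (s + 1) u))"
proof -
  note T = \<open>T > 0\<close> and \<mu> = \<open>\<mu> > 0\<close>
  \<comment> \<open>\<open>K\<close> settles s = 1 and, multiplied by \<open>C\<^sub>a\<close>,
    large h; \<open>L\<close> settles h <= T \<open>C\<^sub>I\<close>. The constant is the sum of
    the three, which depends neither on s nor on h.\<close>
  define K where "K = 11 * T + 6 * \<mu> * T ^ 3"
  define L where "L = C\<^sub>a * (3 * (T * C\<^sub>I) + 8 * T + 6 * T * \<mu> * (T * C\<^sub>I)\<^sup>2)"
  have K: "0 < K" and L: "0 < L"
    unfolding K_def L_def
    by (intro add_pos_pos mult_pos_pos zero_less_power zero_less_numeral assms)+
  show ?thesis
  proof (intro exI[of _ "K + K * C\<^sub>a + L"] conjI allI impI ballI)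
    show "0 < K + K * C\<^sub>a + L" using K L assms by (auto intro!: add_pos_pos)
  next
    fix hs S h f u u\<^sub>h and s :: nat
    assume fam: "discrete_family T hs S" and A: "assumption_A T p C\<^sub>I C\<^sub>a hs S" and h: "h \<in> hs"
      and f: "f \<in> L2_space T" and sol: "continuous_solution T \<mu> f u"
      and dsol: "discrete_solution T \<mu> (S h) f u\<^sub>h" and s: "1 \<le> s" "s \<le> p"
      and u: "u \<in> H20 T \<inter> H_space (s + 1) T"
    have hpos: "0 < h" and V: "finite_dim_subspace (S h)" "S h \<subseteq> H20 T"
      using fam h by (auto simp: discrete_family_def)
    have uh: "u\<^sub>h \<in> S h" using dsol by (simp add: discrete_solution_def)
    have H2: "H20 T \<subseteq> H_space 2 T" by (auto simp: H20_def)
    obtain U U1 where repu: "H2_rep T u U U1 (wderiv T 2 u)"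
      using H2_rep_exists[OF T, of u] u H2 by blast
    obtain H H1 where reph: "H2_rep T u\<^sub>h H H1 (wderiv T 2 u\<^sub>h)"
      using H2_rep_exists[OF T, of u\<^sub>h] uh V H2 by blast
    define N where "N = L2_nrm T (wderiv T (s + 1) u)"
    have N: "0 \<le> N" unfolding N_def by (rule L2_nrm_nonneg)
    define E where "E = L2_nrm T (\<lambda>t. U1 t - H1 t)"
    have hN: "0 \<le> h ^ (s - 1) * N" using hpos N by simp
    have stab: "E \<le> K * L2_nrm T (wderiv T 2 u)"
      unfolding E_def K_def by (rule galerkin_stability_bound[OF T \<mu> V f sol dsol repu reph])
    have "E \<le> K * (h ^ (s - 1) * N) \<or> E \<le> K * C\<^sub>a * (h ^ (s - 1) * N) \<or> E \<le> L * (h ^ (s - 1) * N)"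
    proof (cases "s = 1")
      case True
      \<comment> \<open>Here the power of h is 1 and \<open>N\<close> is the norm of the second
        derivative, so the stability bound is already the claim.\<close>
      then show ?thesis using stab by (simp add: N_def numeral_2_eq_2)
    next
      case False
      with s have s2: "2 \<le> s" by simp
      obtain v where v: "v \<in> S h"
        and approx: "\<forall>l\<in>{0, 1, 2}. l \<le> s \<longrightarrow>
          L2_nrm T (\<lambda>t. wderiv T l u t - wderiv T l v t) \<le> C\<^sub>a * h ^ (s + 1 - l) * N"
        using A h s(2) u unfolding assumption_A_def approximation_property_def N_def by blast
      obtain W W1 where repv: "H2_rep T v W W1 (wderiv T 2 v)"
        using H2_rep_exists[OF T, of v] v V H2 by blast
      note D = L2_nrm_wderiv_diff[OF T repu repv]
      obtain m where m: "s = Suc m" using s by (cases s) auto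
      have d: "L2_nrm T (\<lambda>t. wderiv T l u t - wderiv T l v t) \<le> C\<^sub>a * h ^ (s + 1 - l) * N"
        if "l \<in> {0, 1, 2}" "l \<le> s" for l
        using approx that by blast
      \<comment> \<open>The common factor h^(s - 1) is split off; orders 0 and 1 keep a surplus of
        h^2 and h, which remains to be bounded independently of h.\<close>
      have "h ^ (s + 1 - 0) = h\<^sup>2 * h ^ (s - 1)" "h ^ (s + 1 - 1) = h * h ^ (s - 1)"
        "h ^ (s + 1 - 2) = h ^ (s - 1)"
        by (simp_all add: m power2_eq_square)
      then have d0: "L2_nrm T (\<lambda>t. U t - W t) \<le> C\<^sub>a * h\<^sup>2 * (h ^ (s - 1) * N)"
        and d1: "L2_nrm T (\<lambda>t. U1 t - W1 t) \<le> C\<^sub>a * h * (h ^ (s - 1) * N)"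
        and d2: "L2_nrm T (\<lambda>t. wderiv T 2 u t - wderiv T 2 v t) \<le> C\<^sub>a * (h ^ (s - 1) * N)"
        using d[of 0] d[of 1] d[of 2] s2 unfolding D(1,2) by (simp_all add: power2_eq_square mult.assoc)
      show ?thesis
      proof (cases "T * C\<^sub>I < h")
        case True
        have inv: "inverse_inequalities T C\<^sub>I hs S" using A by (simp add: assumption_A_def)
        have "v \<in> H20 T" using v V by blast
        from inverse_inequalities_large_h[OF T inv h hpos True v this repv]
        have W2: "L2_nrm T (wderiv T 2 v) = 0" .
        \<comment> \<open>Since the second derivative of \<open>v\<close> has norm 0, the
          approximation estimate bounds the second derivative of u itself, and the stability bound
          applies with no surplus power of h.\<close>
        have "L2_nrm T (\<lambda>t. (wderiv T 2 u t - wderiv T 2 v t) + wderiv T 2 v t)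
            \<le> L2_nrm T (\<lambda>t. wderiv T 2 u t - wderiv T 2 v t) + L2_nrm T (wderiv T 2 v)"
          by (intro L2_nrm_triangle L2_space_diff H2_rep_L2[OF T repu] H2_rep_L2[OF T repv])
        then have "L2_nrm T (wderiv T 2 u) \<le> C\<^sub>a * (h ^ (s - 1) * N)"
          using d2 W2 by simp
        then have "K * L2_nrm T (wderiv T 2 u) \<le> K * (C\<^sub>a * (h ^ (s - 1) * N))"
          using K by (intro mult_left_mono) auto
        then have "E \<le> K * C\<^sub>a * (h ^ (s - 1) * N)"
          using stab by (simp add: mult.assoc)
        then show ?thesis by blast
      next
        case False
        then have hle: "h \<le> T * C\<^sub>I" by simp
        have Ca: "0 \<le> C\<^sub>a" using assms by simp
        have "C\<^sub>a * h * (h ^ (s - 1) * N) \<le> C\<^sub>a * (T * C\<^sub>I) * (h ^ (s - 1) * N)"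
          by (intro mult_right_mono mult_left_mono hle hN Ca)
        with d1 have d1': "3 * L2_nrm T (\<lambda>t. U1 t - W1 t) \<le> 3 * (C\<^sub>a * (T * C\<^sub>I) * (h ^ (s - 1) * N))"
          by linarith
        have "C\<^sub>a * h\<^sup>2 * (h ^ (s - 1) * N) \<le> C\<^sub>a * (T * C\<^sub>I)\<^sup>2 * (h ^ (s - 1) * N)"
          using hpos by (intro mult_right_mono mult_left_mono power_mono hle hN Ca) auto
        with d0 have "L2_nrm T (\<lambda>t. U t - W t) \<le> C\<^sub>a * (T * C\<^sub>I)\<^sup>2 * (h ^ (s - 1) * N)"
          by linarith
        then have d0': "6 * T * \<mu> * L2_nrm T (\<lambda>t. U t - W t)
            \<le> 6 * T * \<mu> * (C\<^sub>a * (T * C\<^sub>I)\<^sup>2 * (h ^ (s - 1) * N))"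
          using T \<mu> by (intro mult_left_mono) auto
        have d2': "8 * T * L2_nrm T (\<lambda>t. wderiv T 2 u t - wderiv T 2 v t)
            \<le> 8 * T * (C\<^sub>a * (h ^ (s - 1) * N))"
          using T d2 by (intro mult_left_mono) auto
        have "L * (h ^ (s - 1) * N) = 3 * (C\<^sub>a * (T * C\<^sub>I) * (h ^ (s - 1) * N))
            + 8 * T * (C\<^sub>a * (h ^ (s - 1) * N)) + 6 * T * \<mu> * (C\<^sub>a * (T * C\<^sub>I)\<^sup>2 * (h ^ (s - 1) * N))"
          unfolding L_def by (simp add: algebra_simps)
        then have "E \<le> L * (h ^ (s - 1) * N)"
          using galerkin_error_bound[OF T \<mu> V sol dsol v repu reph repv] d0' d1' d2'
          unfolding E_def by linarith
        then show ?thesis by blast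
      qed
    qed
    moreover have "0 \<le> K * (h ^ (s - 1) * N)" "0 \<le> K * C\<^sub>a * (h ^ (s - 1) * N)" "0 \<le> L * (h ^ (s - 1) * N)"
      using K L assms hN by (auto intro!: mult_nonneg_nonneg)
    ultimately have "E \<le> K * (h ^ (s - 1) * N) + K * C\<^sub>a * (h ^ (s - 1) * N) + L * (h ^ (s - 1) * N)"
      by linarith
    then show "L2_nrm T (\<lambda>t. wderiv T 1 u t - wderiv T 1 u\<^sub>h t)
        \<le> (K + K * C\<^sub>a + L) * h ^ (s - 1) * L2_nrm T (wderiv T (s + 1) u)"
      unfolding L2_nrm_wderiv_diff(2)[OF T repu reph] E_def[symmetric] N_def[symmetric]
      by (simp add: algebra_simps)
  qed
qed

end
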